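(* Let $(p_j)_{j\ge1}$ be the Erdős–Taylor sequence defined by $p_1=1$ and $p_{j+1}=j\,p_j+1$ for $j\ge1$. For every $q\ge0$ let $I_q=(2^q,2^{q+1}]\cap\mathbb{N}$. Fix an increasing sequence of integers $0=q_0<q_1<q_2<\cdots$ such that $N_\ell:=q_{\ell+1}-q_\ell\to\infty$ as $\ell\to\infty$, and set $$J_\ell=\bigcup_{q_\ell\le q<q_{\ell+1}} I_q,\qquad \mathscr{S}_\ell=\Bigl\{\sum_{j\in F}p_j : F\subseteq J_\ell\Bigr\},\qquad \ell\ge0.$$ Let $(n_k)_{k\ge0}$ be the increasing enumeration of the set $D=\bigcup_{\ell\ge0}\mathscr{S}_\ell$. Then $(n_k)_{k\ge0}$ is a rigidity sequence which is dense in the Bohr compactification $b\mathbb{Z}$ of $\mathbb{Z}$.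
   Context: $\mathbb{T}=\{z\in\mathbb{C}: |z|=1\}$. For a Borel probability measure $\mu$ on $\mathbb{T}$ and $n\in\mathbb{Z}$, $\widehat{\mu}(n)=\int_{\mathbb{T}} z^n\,d\mu(z)$. A sequence of integers $(n_k)_{k\ge 0}$ is a rigidity sequence if there exists a Borel probability measure $\mu$ on $\mathbb{T}$ with $\mu(\{z\})=0$ for all $z\in\mathbb{T}$ such that $\widehat{\mu}(n_k)\to 1$ as $k\to\infty$. The Bohr compactification $b\mathbb{Z}$ is the compact group of all (not necessarily continuous) group homomorphisms $\chi:\mathbb{T}\to\mathbb{T}$ with the topology of pointwise convergence; $\mathbb{Z}$ is viewed as a (dense) subgroup of $b\mathbb{Z}$ by identifying $n\in\mathbb{Z}$ with $\chi_n(z)=z^n$. A sequence of integers is dense in $b\mathbb{Z}$ if its set of values is a dense subset of $b\mathbb{Z}$. *)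

theory Defs
  imports "HOL-Probability.Probability"
begin

abbreviation unit_circle :: "complex set" where
  "unit_circle \<equiv> sphere 0 1"

definition borel_prob_on_circle :: "complex measure \<Rightarrow> bool" where
  "borel_prob_on_circle \<mu> \<longleftrightarrow>
     prob_space \<mu> \<and> sets \<mu> = sets (restrict_space borel unit_circle)"

definition fourier_coeff :: "complex measure \<Rightarrow> int \<Rightarrow> complex" where
  "fourier_coeff \<mu> n = (LINT z|\<mu>. z powi n)"

definition rigidity_sequence :: "(nat \<Rightarrow> int) \<Rightarrow> bool" where
  "rigidity_sequence n \<longleftrightarrow>
     (\<exists>\<mu>. borel_prob_on_circle \<mu> \<and> (\<forall>z\<in>unit_circle. measure \<mu> {z} = 0) \<and>
          (\<lambda>k. fourier_coeff \<mu> (n k)) \<longlonglongrightarrow> 1)"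

text \<open>
  Homomorphisms of the circle group are represented by functions that are \<^const>\<open>undefined\<close>
  outside the circle, so that they lie in the topological product below.
\<close>

definition circle_homs :: "(complex \<Rightarrow> complex) set" where
  "circle_homs = {h \<in> unit_circle \<rightarrow>\<^sub>E unit_circle.
     \<forall>z\<in>unit_circle. \<forall>w\<in>unit_circle. h (z * w) = h z * h w}"

definition bohr_topology :: "(complex \<Rightarrow> complex) topology" where
  "bohr_topology =
     subtopology (product_topology (\<lambda>_. top_of_set unit_circle) unit_circle) circle_homs"

definition int_char :: "int \<Rightarrow> complex \<Rightarrow> complex" where
  "int_char n = (\<lambda>z\<in>unit_circle. z powi n)"

definition dense_in_bohr :: "(nat \<Rightarrow> int) \<Rightarrow> bool" where
  "dense_in_bohr n \<longleftrightarrow>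
     bohr_topology closure_of range (\<lambda>k. int_char (n k)) = topspace bohr_topology"

text \<open>The sequence is indexed from 1; its value at 0 is a dummy.\<close>

fun erdos_taylor :: "nat \<Rightarrow> nat" where
  "erdos_taylor 0 = 0"
| "erdos_taylor (Suc 0) = 1"
| "erdos_taylor (Suc (Suc j)) = Suc j * erdos_taylor (Suc j) + 1"

definition dyadic_block :: "nat \<Rightarrow> nat set" where
  "dyadic_block q = {2 ^ q <.. 2 ^ (q + 1)}"

definition long_block :: "(nat \<Rightarrow> nat) \<Rightarrow> nat \<Rightarrow> nat set" where
  "long_block q l = (\<Union>r\<in>{q l..<q (l + 1)}. dyadic_block r)"

definition block_sums :: "(nat \<Rightarrow> nat) \<Rightarrow> nat \<Rightarrow> nat set" where
  "block_sums q l = {\<Sum>j\<in>F. erdos_taylor j | F. F \<subseteq> long_block q l}"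

lemma int_char_in_circle_homs: "int_char n \<in> circle_homs"
  by (auto simp: int_char_def circle_homs_def power_int_mult_distrib norm_mult norm_power_int)

lemma topspace_bohr_topology: "topspace bohr_topology = circle_homs"
  by (auto simp: bohr_topology_def circle_homs_def)

lemma infinite_block_sums:
  assumes "strict_mono q"
  shows "infinite (\<Union>l. block_sums q l)"
proof -
  have ge: "m \<le> erdos_taylor (2 ^ (q m + 1))" for m
  proof -
    have *: "j \<le> erdos_taylor (Suc j)" for j
    proof (induction j)
      case (Suc j)
      have "1 \<le> erdos_taylor (Suc j)"
        by (cases j) simp_all
      then have "Suc j * 1 \<le> Suc j * erdos_taylor (Suc j)"
        by (intro mult_le_mono) simp_all
      then show ?case by simp
    qed simp
    have "m < 2 ^ (q m + 1)"
      using strict_mono_imp_increasing[OF assms, of m] less_exp[of "q m + 1"] by linarith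
    then obtain j where "2 ^ (q m + 1) = Suc j" "m \<le> j"
      by (metis less_Suc_eq_le less_imp_Suc_add not0_implies_Suc not_less_zero)
    then show ?thesis using *[of j] by simp
  qed
  have mem: "erdos_taylor (2 ^ (q m + 1)) \<in> (\<Union>l. block_sums q l)" for m
  proof -
    have "2 ^ (q m + 1) \<in> long_block q m"
      using strict_monoD[OF assms, of m "m + 1"]
      by (auto simp: long_block_def dyadic_block_def intro!: bexI[of _ "q m"])
    then have "(\<Sum>j\<in>{2 ^ (q m + 1)}. erdos_taylor j) \<in> block_sums q m"
      unfolding block_sums_def by blast
    then show ?thesis by auto
  qed
  show ?thesis
    unfolding infinite_nat_iff_unbounded_le using ge mem by blast
qed

end

theory Submission
  imports Defs "HOL-Real_Asymp.Real_Asymp"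
begin

text \<open>
  Rigidity. Let \<open>A\<^sub>K\<^sub>+\<^sub>1 = K A\<^sub>K + m\<^sub>K\<close> with random bits \<open>m\<^sub>K\<close> and put \<open>t\<^sub>K = A\<^sub>K / p\<^sub>K\<close>. The recursion for \<open>p\<close> gives
  \<open>t\<^sub>K\<^sub>+\<^sub>1 - t\<^sub>K = (m\<^sub>K - t\<^sub>K) / p\<^sub>K\<^sub>+\<^sub>1\<close>, so if \<open>m\<^sub>K = 1\<close> has conditional probability \<open>t\<^sub>K\<close>, then \<open>t\<close> is a bounded
  martingale; the measure is the law of its limit \<open>\<theta>\<close>, transported to the circle. As \<open>p\<^sub>j t\<^sub>j\<close> is an integer, for
  \<open>n = \<Sum>j\<in>F. p\<^sub>j\<close> the number \<open>n \<theta>\<close> agrees modulo 1 with \<open>\<Sum>j\<in>F. p\<^sub>j (\<theta> - t\<^sub>j)\<close>, and orthogonality of the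
  martingale increments bounds the second moment of the latter by a constant over \<open>min F\<close>, whatever \<open>F\<close> is.
  The law has no atoms because \<open>t\<close> stays away from 0 and 1.

  Density. For \<open>w \<noteq> 1\<close> on the circle, every dyadic block has a subset \<open>G\<close> for which \<open>w\<close> raised to the sum of \<open>p\<^sub>j\<close>
  over \<open>G\<close> is bounded away from 1. Choosing such sets for many blocks and uniting a uniformly random
  subfamily of them yields averages over elements of \<open>D\<close> of the characters \<open>n \<mapsto> w\<^sup>n\<close> that are arbitrarily small, for
  finitely many \<open>w\<close> simultaneously. Testing these averages against a nonnegative trigonometric polynomial concentrated near a
  given homomorphism gives an element of \<open>D\<close> near that homomorphism.
\<close>

section \<open>Subset sums within dyadic blocks\<close>

text \<open>Adjoining \<open>x\<close> to \<open>G\<close> changes the gap between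
  \<open>prod w G - 1\<close> and its linearisation by \<open>(prod w G - 1) * (w x - 1)\<close>,
  which is controlled because every subproduct stays within \<open>c\<close> of 1.\<close>

lemma norm_sum_minus_one_le:
  fixes w :: "'i \<Rightarrow> complex"
  assumes "finite G" "\<And>H. H \<subseteq> G \<Longrightarrow> norm (prod w H - 1) \<le> c"
  shows "norm (\<Sum>j\<in>G. w j - 1) \<le> norm (prod w G - 1) + c * (\<Sum>j\<in>G. norm (w j - 1))"
proof -
  have "norm (prod w G - 1 - (\<Sum>j\<in>G. w j - 1)) \<le> c * (\<Sum>j\<in>G. norm (w j - 1))"
    using assms
  proof (induction G rule: finite_induct)
    case (insert x G)
    have "prod w (insert x G) - 1 - (\<Sum>j\<in>insert x G. w j - 1)
        = (prod w G - 1 - (\<Sum>j\<in>G. w j - 1)) + (prod w G - 1) * (w x - 1)"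
      using insert by (simp add: algebra_simps)
    also have "norm \<dots> \<le> c * (\<Sum>j\<in>G. norm (w j - 1)) + c * norm (w x - 1)"
      using insert by (intro order.trans[OF norm_triangle_ineq] add_mono)
        (auto simp: norm_mult intro!: mult_right_mono)
    finally show ?case using insert by (simp add: algebra_simps)
  qed simp
  then show ?thesis
    using norm_triangle_ineq2[of "\<Sum>j\<in>G. w j - 1" "prod w G - 1"] by (simp add: norm_minus_commute)
qed

text \<open>With \<open>T\<close> the sum to be bounded, linearisation gives at most
  \<open>c + c * T\<close> for every subset of \<open>A\<close>. Using this on \<open>A\<close> for
  the real parts, and on the indices with either sign of the imaginary part, yields
  \<open>T \<le> 3 * c + 3 * (c * T)\<close>, and \<open>c \<le> 1 / 6\<close> absorbs half of
  \<open>T\<close>.\<close>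

lemma sum_norm_minus_one_le:
  fixes w :: "'i \<Rightarrow> complex"
  assumes "finite A" "\<And>j. j \<in> A \<Longrightarrow> norm (w j) = 1"
    and c: "\<And>H. H \<subseteq> A \<Longrightarrow> norm (prod w H - 1) \<le> c" "c \<le> 1 / 6"
  shows "(\<Sum>j\<in>A. norm (w j - 1)) \<le> 6 * c"
proof -
  define T where "T = (\<Sum>j\<in>A. norm (w j - 1))"
  have "0 \<le> c" using c(1)[of "{}"] by simp
  have bound: "norm (\<Sum>j\<in>G. w j - 1) \<le> c + c * T" if "G \<subseteq> A" for G
  proof -
    have "norm (\<Sum>j\<in>G. w j - 1) \<le> norm (prod w G - 1) + c * (\<Sum>j\<in>G. norm (w j - 1))"
      using that assms finite_subset by (intro norm_sum_minus_one_le) auto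
    also have "\<dots> \<le> c + c * T"
      unfolding T_def using that assms \<open>0 \<le> c\<close>
      by (intro add_mono mult_left_mono sum_mono2) auto
    finally show ?thesis .
  qed
  define P where "P = {j \<in> A. 0 \<le> Im (w j)}"
  define N where "N = {j \<in> A. Im (w j) < 0}"
  have A: "A = P \<union> N" "P \<inter> N = {}" "finite P" "finite N" using assms(1) by (auto simp: P_def N_def)
  have "T \<le> (\<Sum>j\<in>A. - Re (w j - 1) + \<bar>Im (w j - 1)\<bar>)"
    unfolding T_def
  proof (intro sum_mono)
    fix j assume "j \<in> A"
    then have "Re (w j) \<le> 1" using complex_Re_le_cmod[of "w j"] assms(2) by simp
    then show "norm (w j - 1) \<le> - Re (w j - 1) + \<bar>Im (w j - 1)\<bar>"
      using cmod_le[of "w j - 1"] by simp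
  qed
  also have "\<dots> = - Re (\<Sum>j\<in>A. w j - 1) + (\<Sum>j\<in>A. \<bar>Im (w j - 1)\<bar>)"
    by (simp add: sum.distrib sum_negf sum_subtractf)
  also have "(\<Sum>j\<in>A. \<bar>Im (w j - 1)\<bar>) = (\<Sum>j\<in>P. \<bar>Im (w j - 1)\<bar>) + (\<Sum>j\<in>N. \<bar>Im (w j - 1)\<bar>)"
    unfolding A(1) using A by (intro sum.union_disjoint) auto
  also have "(\<Sum>j\<in>P. \<bar>Im (w j - 1)\<bar>) = Im (\<Sum>j\<in>P. w j - 1)"
    by (simp add: P_def)
  also have "(\<Sum>j\<in>N. \<bar>Im (w j - 1)\<bar>) = - Im (\<Sum>j\<in>N. w j - 1)"
    by (simp add: N_def sum_negf)
  also have "- Re (\<Sum>j\<in>A. w j - 1) + (Im (\<Sum>j\<in>P. w j - 1) + - Im (\<Sum>j\<in>N. w j - 1))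
    \<le> 3 * (c + c * T)"
    using bound[of A] bound[of P] bound[of N] A(1)
      abs_Re_le_cmod[of "\<Sum>j\<in>A. w j - 1"] abs_Im_le_cmod[of "\<Sum>j\<in>P. w j - 1"]
      abs_Im_le_cmod[of "\<Sum>j\<in>N. w j - 1"] by (simp only: abs_le_iff) auto
  finally have "T \<le> 3 * c + 3 * (c * T)" by simp
  moreover have "c * T \<le> 1 / 6 * T" using c(2) by (intro mult_right_mono) (auto simp: T_def sum_nonneg)
  ultimately show ?thesis by (simp add: T_def)
qed

lemma norm_power_minus_one_le:
  fixes z :: complex
  assumes "norm z = 1"
  shows "norm (z ^ n - 1) \<le> real n * norm (z - 1)"
proof -
  have "norm (z ^ n - 1 ^ n) \<le> real n * norm (z - 1)"
    using assms by (intro norm_power_diff) auto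
  then show ?thesis by simp
qed

lemma erdos_taylor_Suc: "0 < j \<Longrightarrow> erdos_taylor (Suc j) = j * erdos_taylor j + 1"
  by (cases j) auto

text \<open>Since \<open>p\<^sub>j\<^sub>+\<^sub>1 - j p\<^sub>j = 1\<close>, the numbers \<open>z\<^bsup>p\<^sub>j\<^esup>\<close>
  cannot be too close to \<open>1\<close> throughout a dyadic block.\<close>

lemma sum_norm_dyadic_block_ge:
  fixes z :: complex
  assumes z: "norm z = 1" and "1 \<le> q"
  shows "norm (z - 1) / 5 \<le> (\<Sum>j\<in>dyadic_block q. norm (z ^ erdos_taylor j - 1))"
proof -
  define T where "T = (\<Sum>j\<in>dyadic_block q. norm (z ^ erdos_taylor j - 1))"
  define f where "f j = norm (z ^ erdos_taylor j - 1)" for j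
  define a :: nat where "a = 2 ^ q"
  have a2: "2 \<le> a" unfolding a_def using \<open>1 \<le> q\<close> by (metis one_le_numeral power_increasing power_one_right)
  have block: "dyadic_block q = {a<..2 * a}" by (simp add: dyadic_block_def a_def)
  have step: "norm (z - 1) \<le> f (Suc j) + real j * f j" if "0 < j" for j
  proof -
    let ?u = "z ^ erdos_taylor j"
    have "norm (z - 1) = norm (?u ^ j * (z - 1))" using z by (simp add: norm_mult norm_power)
    also have "?u ^ j * (z - 1) = (z ^ erdos_taylor (Suc j) - 1) - (?u ^ j - 1)"
      using that by (simp add: erdos_taylor_Suc power_mult[symmetric] algebra_simps)
    also have "norm \<dots> \<le> f (Suc j) + norm (?u ^ j - 1)"
      unfolding f_def by (rule norm_triangle_ineq4)
    also have "norm (?u ^ j - 1) \<le> real j * f j"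
      unfolding f_def using z by (intro norm_power_minus_one_le) (simp add: norm_power)
    finally show ?thesis by simp
  qed
  \<comment> \<open>Only those \<open>j\<close> are used for which \<open>j\<close> and
    \<open>Suc j\<close> both lie in the block; there are \<open>a - 1\<close> of them.\<close>
  have "(real a - 1) * norm (z - 1) = (\<Sum>j\<in>{a<..<2 * a}. norm (z - 1))"
    using a2 by (simp add: of_nat_diff)
  also have "\<dots> \<le> (\<Sum>j\<in>{a<..<2 * a}. f (Suc j) + real (2 * a) * f j)"
  proof (intro sum_mono)
    fix j assume j: "j \<in> {a<..<2 * a}"
    then have "real j * f j \<le> real (2 * a) * f j"
      by (intro mult_right_mono) (auto simp: f_def)
    then show "norm (z - 1) \<le> f (Suc j) + real (2 * a) * f j"
      using step[of j] j by fastforce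
  qed
  also have "\<dots> = (\<Sum>j\<in>Suc ` {a<..<2 * a}. f j) + real (2 * a) * (\<Sum>j\<in>{a<..<2 * a}. f j)"
    by (simp add: sum.distrib sum_distrib_left sum.reindex)
  also have "\<dots> \<le> T + real (2 * a) * T"
    unfolding T_def f_def[symmetric] block
    by (intro add_mono mult_left_mono sum_mono2) (auto simp: f_def)
  finally have "(real a - 1) * norm (z - 1) \<le> (1 + 2 * real a) * T" by (simp add: algebra_simps)
  \<comment> \<open>The constant 5 is what \<open>2 \<le> a\<close> allows, with equality at
    \<open>a = 2\<close>; this is where \<open>1 \<le> q\<close> enters.\<close>
  moreover have "(1 + 2 * real a) * (norm (z - 1) / 5) \<le> (real a - 1) * norm (z - 1)"
  proof -
    have "2 \<le> real a" using a2 by linarith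
    then have "((1 + 2 * real a) / 5) * norm (z - 1) \<le> (real a - 1) * norm (z - 1)"
      by (intro mult_right_mono) auto
    then show ?thesis by simp
  qed
  ultimately have "(1 + 2 * real a) * (norm (z - 1) / 5) \<le> (1 + 2 * real a) * T" by linarith
  then show ?thesis unfolding T_def
    by (rule mult_left_le_imp_le) (simp add: add_pos_nonneg)
qed

lemma finite_dyadic_block [simp]: "finite (dyadic_block q)"
  by (simp add: dyadic_block_def)

text \<open>If all subset products in a block were within \<open>?c\<close> of 1, the factors would
  deviate from 1 by at most \<open>6 * ?c\<close> in total, and 6/40 < 1/5 contradicts the lower
  bound for the block. The cap \<open>1 / 6\<close> is the hypothesis of
  \<open>sum_norm_minus_one_le\<close>.\<close>

lemma dyadic_block_subset_sum_far:
  fixes z :: complex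
  assumes z: "norm z = 1" "z \<noteq> 1"
  shows "\<exists>c>0. \<forall>q\<ge>1. \<exists>G\<subseteq>dyadic_block q. c \<le> norm (z ^ (\<Sum>j\<in>G. erdos_taylor j) - 1)"
proof -
  let ?c = "min (1 / 6) (norm (z - 1) / 40)"
  have far: "\<exists>G\<subseteq>dyadic_block q. ?c \<le> norm (z ^ (\<Sum>j\<in>G. erdos_taylor j) - 1)"
    if q: "1 \<le> q" for q
  proof (rule ccontr)
    assume "\<not> ?thesis"
    then have "norm (z ^ (\<Sum>j\<in>H. erdos_taylor j) - 1) \<le> ?c" if "H \<subseteq> dyadic_block q" for H
      using that by (meson linear)
    then have "norm (prod (\<lambda>j. z ^ erdos_taylor j) H - 1) \<le> ?c" if "H \<subseteq> dyadic_block q" for H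
      using that by (simp only: power_sum)
    then have "(\<Sum>j\<in>dyadic_block q. norm (z ^ erdos_taylor j - 1)) \<le> 6 * ?c"
      using z by (intro sum_norm_minus_one_le) (auto simp: norm_power)
    moreover have "6 * ?c \<le> 6 * (norm (z - 1) / 40)" by simp
    moreover have "0 < norm (z - 1)" using z by simp
    ultimately show False
      using sum_norm_dyadic_block_ge[OF z(1) q] by simp
  qed
  show ?thesis using far z by (intro exI[of _ ?c]) simp
qed

text \<open>By the parallelogram law, the squares of \<open>norm (1 + u)\<close> and
  \<open>norm (u - 1)\<close> add up to 4.\<close>

lemma norm_mean_with_one_le:
  fixes u :: complex
  assumes "norm u = 1" "c \<le> norm (u - 1)" "0 \<le> c"
  shows "norm ((1 + u) / 2) \<le> sqrt (1 - (c / 2)\<^sup>2)"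
proof -
  have 1: "(Re u)\<^sup>2 + (Im u)\<^sup>2 = 1" using assms(1) by (simp add: cmod_def)
  have "(norm (1 + u))\<^sup>2 + (norm (u - 1))\<^sup>2 = 4"
    using 1 unfolding cmod_power2 by (simp add: power2_eq_square algebra_simps)
  moreover have "c\<^sup>2 \<le> (norm (u - 1))\<^sup>2" using assms by (intro power_mono) auto
  ultimately have "(norm ((1 + u) / 2))\<^sup>2 \<le> 1 - (c / 2)\<^sup>2"
    by (simp add: norm_divide power_divide)
  then show ?thesis by (rule real_le_rsqrt)
qed

lemma norm_mean_with_one_le_one: "norm u = 1 \<Longrightarrow> norm ((1 + u) / 2) \<le> (1::real)" for u :: complex
  using norm_triangle_ineq[of 1 u] by (simp add: norm_divide)

text \<open>A new point \<open>w\<close> is served by appending \<open>K\<close> blocks in which its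
  factors are at most \<open>r < 1\<close>. The points treated before lose nothing, since all
  factors have norm at most 1. The length \<open>N\<close> is independent of the start
  \<open>a\<close>, so it can be fixed before a long block is chosen.\<close>

lemma dyadic_block_means_small:
  fixes W :: "complex set"
  assumes "finite W" "W \<subseteq> unit_circle - {1}" "0 < \<epsilon>"
  shows "\<exists>N. \<forall>a\<ge>1. \<exists>G. (\<forall>q. G q \<subseteq> dyadic_block q) \<and>
    (\<forall>w\<in>W. norm (\<Prod>q\<in>{a..<a + N}. (1 + w ^ (\<Sum>j\<in>G q. erdos_taylor j)) / 2) < \<epsilon>)"
  using assms(1,2)
proof (induction W rule: finite_induct)
  case empty
  then show ?case by auto
next
  case (insert w W)
  then obtain N where N: "\<And>a. a \<ge> 1 \<Longrightarrow> \<exists>G. (\<forall>q. G q \<subseteq> dyadic_block q) \<and>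
    (\<forall>w\<in>W. norm (\<Prod>q\<in>{a..<a + N}. (1 + w ^ (\<Sum>j\<in>G q. erdos_taylor j)) / 2) < \<epsilon>)"
    by auto
  have w: "norm w = 1" "w \<noteq> 1" using insert by auto
  obtain c where c: "c > 0"
    "\<And>q. q \<ge> 1 \<Longrightarrow> \<exists>G\<subseteq>dyadic_block q. c \<le> norm (w ^ (\<Sum>j\<in>G. erdos_taylor j) - 1)"
    using dyadic_block_subset_sum_far[OF w] by auto
  then obtain H where H: "\<And>q. q \<ge> 1 \<Longrightarrow> H q \<subseteq> dyadic_block q"
    "\<And>q. q \<ge> 1 \<Longrightarrow> c \<le> norm (w ^ (\<Sum>j\<in>H q. erdos_taylor j) - 1)" by metis
  define r where "r = sqrt (1 - (c / 2)\<^sup>2)"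
  have r: "norm ((1 + w ^ (\<Sum>j\<in>H q. erdos_taylor j)) / 2) \<le> r" if "q \<ge> 1" for q
    unfolding r_def using H[OF that] w c by (intro norm_mean_with_one_le) (auto simp: norm_power)
  have "0 \<le> r" using r[of 1] norm_ge_zero order.trans by blast
  have "r < 1" using c unfolding r_def by simp
  then obtain K where K: "r ^ K < \<epsilon>"
    using real_arch_pow_inv assms(3) by blast
  show ?case
  proof (intro exI[of _ "N + K"] allI impI)
    fix a :: nat assume a: "1 \<le> a"
    obtain G where G: "\<And>q. G q \<subseteq> dyadic_block q"
      "\<And>w. w \<in> W \<Longrightarrow> norm (\<Prod>q\<in>{a..<a + N}. (1 + w ^ (\<Sum>j\<in>G q. erdos_taylor j)) / 2) < \<epsilon>"
      using N[OF a] by auto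
    define G' where "G' q = (if q < a + N then G q else H q)" for q
    define h where "h v q = norm ((1 + v ^ (\<Sum>j\<in>G' q. erdos_taylor j)) / 2)" for v :: complex and q
    have h: "0 \<le> h v q" "h v q \<le> 1" if "v \<in> insert w W" for v q
    proof -
      show "0 \<le> h v q" by (simp add: h_def)
      have "norm v = 1" using that insert.prems by auto
      then show "h v q \<le> 1"
        unfolding h_def by (intro norm_mean_with_one_le_one) (simp add: norm_power)
    qed
    have split: "(\<Prod>q\<in>{a..<a + (N + K)}. h v q) = (\<Prod>q\<in>{a..<a + N}. h v q) * (\<Prod>q\<in>{a + N..<a + N + K}. h v q)" for v
      by (subst prod.atLeastLessThan_concat) (auto simp: add.assoc)
    have "(\<Prod>q\<in>{a..<a + (N + K)}. h v q) < \<epsilon>" if v: "v \<in> insert w W" for v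
    proof (cases "v = w")
      case True
      have "(\<Prod>q\<in>{a + N..<a + N + K}. h v q) \<le> (\<Prod>q\<in>{a + N..<a + N + K}. r)"
        using a r True by (intro prod_mono) (auto simp: h_def G'_def)
      moreover have "(\<Prod>q\<in>{a..<a + N}. h v q) \<le> 1"
        using h[OF v] by (intro prod_le_1) auto
      ultimately have "(\<Prod>q\<in>{a..<a + (N + K)}. h v q) \<le> 1 * r ^ K"
        unfolding split using h[OF v] by (intro mult_mono) (auto intro!: prod_nonneg)
      then show ?thesis using K by simp
    next
      case False
      have "(\<Prod>q\<in>{a..<a + N}. h v q) < \<epsilon>"
        using G(2)[of v] v False unfolding h_def prod_norm by (simp add: G'_def)
      moreover have "(\<Prod>q\<in>{a + N..<a + N + K}. h v q) \<le> 1"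
        using h[OF v] by (intro prod_le_1) auto
      then have "(\<Prod>q\<in>{a..<a + (N + K)}. h v q) \<le> (\<Prod>q\<in>{a..<a + N}. h v q) * 1"
        unfolding split using h[OF v] by (intro mult_left_mono) (auto intro!: prod_nonneg)
      ultimately show ?thesis by simp
    qed
    moreover have "G' q \<subseteq> dyadic_block q" for q
      using G(1) H(1)[of q] a by (auto simp: G'_def)
    ultimately show "\<exists>G. (\<forall>q. G q \<subseteq> dyadic_block q) \<and>
      (\<forall>v\<in>insert w W. norm (\<Prod>q\<in>{a..<a + (N + K)}. (1 + v ^ (\<Sum>j\<in>G q. erdos_taylor j)) / 2) < \<epsilon>)"
      unfolding h_def prod_norm by (intro exI[of _ G']) auto
  qed
qed

section \<open>Density in the Bohr compactification\<close>

lemma norm_circle_hom: "h \<in> circle_homs \<Longrightarrow> norm z = 1 \<Longrightarrow> norm (h z) = 1"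
  unfolding circle_homs_def by force

lemma circle_hom_mult:
  "h \<in> circle_homs \<Longrightarrow> norm z = 1 \<Longrightarrow> norm w = 1 \<Longrightarrow> h (z * w) = h z * h w"
  by (simp add: circle_homs_def)

lemma circle_hom_one:
  assumes "h \<in> circle_homs"
  shows "h 1 = 1"
  using circle_hom_mult[OF assms, of 1 1] norm_circle_hom[OF assms, of 1] by auto

lemma circle_hom_power:
  assumes "h \<in> circle_homs" "norm z = 1"
  shows "h (z ^ k) = h z ^ k"
  using assms by (induction k) (simp_all add: circle_hom_one circle_hom_mult norm_power)

lemma circle_hom_cnj:
  assumes "h \<in> circle_homs" "norm z = 1"
  shows "h (cnj z) = cnj (h z)"
proof -
  have "h z * h (cnj z) = 1"
    using circle_hom_mult[OF assms, of "cnj z"] assms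
    by (simp add: circle_hom_one complex_norm_square[symmetric])
  moreover have "h z * cnj (h z) = 1"
    using norm_circle_hom[OF assms] by (simp add: complex_norm_square[symmetric])
  ultimately show ?thesis by (metis mult_cancel_left mult_zero_left zero_neq_one)
qed

lemma circle_hom_prod:
  assumes "h \<in> circle_homs" "\<And>z. z \<in> Z \<Longrightarrow> norm (f z) = 1"
  shows "h (prod f Z) = (\<Prod>z\<in>Z. h (f z))"
  using assms(2)
proof (induction Z rule: infinite_finite_induct)
  case (insert x F)
  have "norm (prod f F) = (1::real)" using insert.prems by (simp add: prod_norm[symmetric])
  then show ?case using insert assms(1) by (simp add: circle_hom_mult)
qed (use assms(1) in \<open>auto simp: circle_hom_one\<close>)

text \<open>On the circle \<open>(1 + u) * (1 + cnj u) = (1 + u)\<^sup>2 * cnj u\<close>, so the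
  binomial theorem applies. As \<open>u ^ k * cnj u ^ M\<close> is the power of \<open>u\<close>
  with exponent k - M, the constant term is the one at \<open>k = M\<close>, with the central
  binomial coefficient.\<close>

lemma norm_mean_with_one_power:
  fixes u :: complex
  assumes "norm u = 1"
  shows "complex_of_real (norm ((1 + u) / 2) ^ (2 * M))
    = (\<Sum>k\<le>2 * M. complex_of_real (real (2 * M choose k) / 4 ^ M) * (u ^ k * cnj u ^ M))"
proof -
  have u: "u * cnj u = 1" using assms by (simp add: complex_norm_square[symmetric])
  have "complex_of_real (norm ((1 + u) / 2) ^ (2 * M)) = ((1 + u) * (1 + cnj u) / 4) ^ M"
  proof -
    have "complex_of_real ((norm ((1 + u) / 2))\<^sup>2) = (1 + u) * (1 + cnj u) / 4"
      unfolding complex_norm_square by simp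
    then show ?thesis by (simp only: power_mult of_real_power)
  qed
  also have "(1 + u) * (1 + cnj u) = (1 + u)\<^sup>2 * cnj u"
    using u by algebra
  also have "((1 + u)\<^sup>2 * cnj u / 4) ^ M = (u + 1) ^ (2 * M) * (cnj u ^ M / 4 ^ M)"
    by (simp add: power_divide power_mult_distrib power_mult[symmetric] add.commute)
  also have "\<dots> = (\<Sum>k\<le>2 * M. complex_of_real (real (2 * M choose k) / 4 ^ M) * (u ^ k * cnj u ^ M))"
    unfolding binomial_ring[of u 1] sum_distrib_right by (intro sum.cong refl) simp
  finally show ?thesis .
qed

text \<open>
  The kernel \<open>\<Prod>z. \<bar>(1 + z\<^sup>n cnj (h z)) / 2\<bar>\<^bsup>2M\<^esup>\<close> is a trigonometric polynomial in \<open>n\<close> with constant term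
  at least \<open>(2M)\<^bsup>-r\<^esup>\<close>, where \<open>r\<close> is the number of points, but it is exponentially small in \<open>M\<close> unless \<open>z\<^sup>n\<close> is close to
  \<open>h z\<close> for all \<open>z\<close>. No linear independence of the arguments is needed, because
  the product of the \<open>h z\<close> is \<open>1\<close> whenever the corresponding product of the \<open>z\<close> is.
\<close>

lemma circle_hom_approximable:
  fixes D :: "nat set" and Z :: "complex set"
  assumes avg: "\<And>W \<delta>. finite W \<Longrightarrow> W \<subseteq> unit_circle - {1} \<Longrightarrow> 0 < \<delta> \<Longrightarrow>
      \<exists>(I :: 'i set) m. finite I \<and> I \<noteq> {} \<and> m ` I \<subseteq> D \<and>
        (\<forall>w\<in>W. norm (\<Sum>i\<in>I. w ^ m i) \<le> \<delta> * real (card I))"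
    and h: "h \<in> circle_homs" and Z: "finite Z" "Z \<subseteq> unit_circle" and "0 < \<epsilon>"
  shows "\<exists>n\<in>D. \<forall>z\<in>Z. norm (z ^ n - h z) < \<epsilon>"
proof (rule ccontr)
  assume "\<not> ?thesis"
  then have far: "\<exists>z\<in>Z. \<epsilon> \<le> norm (z ^ n - h z)" if "n \<in> D" for n
    using that by (meson not_less)
  define c where "c = min \<epsilon> 1"
  define s where "s = 1 - (c / 2)\<^sup>2"
  have c: "0 < c" "c \<le> 1" "c \<le> \<epsilon>" using \<open>0 < \<epsilon>\<close> by (auto simp: c_def)
  have "(c / 2)\<^sup>2 \<le> (1 / 2)\<^sup>2" using c by (intro power_mono) auto
  then have s: "0 < s" "s < 1" using c by (auto simp: s_def power_divide)
  define r where "r = card Z"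
  \<comment> \<open>\<open>M\<close> is taken so large that twice \<open>s ^ M\<close>, the bound
    for the kernel away from \<open>h\<close>, is still below \<open>1 / (2 * real M) ^ r\<close>,
    the lower bound for the constant coefficient.\<close>
  have "(\<lambda>M. (2 * real M) ^ r * s ^ M) \<longlonglongrightarrow> 0" using s by real_asymp
  then have "\<forall>\<^sub>F M in sequentially. (2 * real M) ^ r * s ^ M < 1 / 2"
    by (rule order_tendstoD) simp
  then obtain M where M: "(2 * real M) ^ r * s ^ M < 1 / 2" "0 < M"
    using eventually_happens[OF eventually_conj[OF _ eventually_gt_at_top[of 0]]] by force
  define b where "b k = real (2 * M choose k) / 4 ^ M" for k
  define bb where "bb g = (\<Prod>z\<in>Z. b (g z))" for g :: "complex \<Rightarrow> nat"
  \<comment> \<open>Expanding the product picks an exponent \<open>g z\<close> in each factor; the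
    resulting monomial is, up to a constant, the character sending \<open>n\<close> to
    \<open>v g ^ n\<close>. The choice \<open>g0\<close> below gives the constant term.\<close>
  define K where "K = (Z \<rightarrow>\<^sub>E {..2 * M})"
  define v where "v g = (\<Prod>z\<in>Z. z ^ g z * cnj z ^ M)" for g :: "complex \<Rightarrow> nat"
  define u where "u n z = z ^ n * cnj (h z)" for n z
  define P where "P n = (\<Prod>z\<in>Z. norm ((1 + u n z) / 2) ^ (2 * M))" for n
  define g0 where "g0 = (\<lambda>z\<in>Z. M)"
  have normZ: "norm z = 1" "norm (h z) = 1" "norm (u n z) = 1" if "z \<in> Z" for z n
  proof -
    show z: "norm z = 1" using that Z by auto
    show "norm (h z) = 1" using norm_circle_hom[OF h z] .
    then show "norm (u n z) = 1" using z by (simp add: u_def norm_mult norm_power)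
  qed
  have finK: "finite K" unfolding K_def using Z by (intro finite_PiE) auto
  have bb0: "0 \<le> bb g" for g unfolding bb_def b_def by (intro prod_nonneg) auto
  have "(\<Sum>g\<in>K. bb g) = (\<Prod>z\<in>Z. \<Sum>k\<le>2 * M. b k)"
    unfolding K_def bb_def using Z by (subst prod_sum_PiE) auto
  also have "(\<Sum>k\<le>2 * M. b k) = 1"
  proof -
    have "(\<Sum>k\<le>2 * M. real (2 * M choose k)) = 4 ^ M"
      using choose_row_sum[of "2 * M"] by (simp flip: of_nat_sum add: power_mult)
    then show ?thesis unfolding b_def by (simp flip: sum_divide_distrib)
  qed
  finally have sum_bb: "(\<Sum>g\<in>K. bb g) = 1" by simp
  have normv: "norm (v g) = 1" for g
    using normZ(1) by (simp add: v_def prod_norm[symmetric] norm_mult norm_power)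
  have hv: "h (v g) = (\<Prod>z\<in>Z. h z ^ g z * cnj (h z) ^ M)" for g
    unfolding v_def using normZ(1) h
    by (subst circle_hom_prod)
      (auto simp: norm_mult norm_power circle_hom_mult circle_hom_power circle_hom_cnj intro!: prod.cong)
  have expand: "complex_of_real (P n) = (\<Sum>g\<in>K. complex_of_real (bb g) * (v g ^ n * cnj (h (v g))))" for n
  proof -
    have "complex_of_real (P n)
        = (\<Prod>z\<in>Z. \<Sum>k\<le>2 * M. complex_of_real (b k) * (u n z ^ k * cnj (u n z) ^ M))"
      unfolding P_def of_real_prod b_def using normZ(3) by (intro prod.cong refl norm_mean_with_one_power)
    also have "\<dots> = (\<Sum>g\<in>K. \<Prod>z\<in>Z. complex_of_real (b (g z)) * (u n z ^ g z * cnj (u n z) ^ M))"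
      unfolding K_def using Z by (intro prod_sum_PiE) auto
    also have "\<dots> = (\<Sum>g\<in>K. complex_of_real (bb g) * (v g ^ n * cnj (h (v g))))"
    proof (intro sum.cong refl)
      fix g
      have "(\<Prod>z\<in>Z. u n z ^ g z * cnj (u n z) ^ M) = v g ^ n * cnj (h (v g))"
        unfolding hv unfolding v_def u_def
        by (simp add: prod_power_distrib prod.distrib power_mult_distrib power_mult[symmetric] mult_ac)
      then show "(\<Prod>z\<in>Z. complex_of_real (b (g z)) * (u n z ^ g z * cnj (u n z) ^ M))
          = complex_of_real (bb g) * (v g ^ n * cnj (h (v g)))"
        by (simp add: bb_def prod.distrib)
    qed
    finally show ?thesis .
  qed
  have P_le: "P n \<le> s ^ M" if n: "n \<in> D" for n
  proof -
    obtain z where z: "z \<in> Z" "\<epsilon> \<le> norm (z ^ n - h z)" using far[OF n] by auto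
    have "norm (z ^ n - h z) = norm ((z ^ n - h z) * cnj (h z))"
      using normZ[OF z(1)] by (simp add: norm_mult)
    also have "(z ^ n - h z) * cnj (h z) = u n z - 1"
      using normZ(2)[OF z(1)] by (simp add: u_def algebra_simps complex_norm_square[symmetric])
    finally have "norm ((1 + u n z) / 2) \<le> sqrt s"
      unfolding s_def using z normZ(3)[OF z(1)] c by (intro norm_mean_with_one_le) auto
    then have 1: "norm ((1 + u n z) / 2) ^ (2 * M) \<le> s ^ M"
      using power_mono[of "norm ((1 + u n z) / 2)" "sqrt s" "2 * M"] s
      by (simp add: power_mult)
    have "P n = norm ((1 + u n z) / 2) ^ (2 * M) * (\<Prod>z\<in>Z - {z}. norm ((1 + u n z) / 2) ^ (2 * M))"
      unfolding P_def using Z(1) z(1) by (rule prod.remove)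
    also have "\<dots> \<le> s ^ M * 1"
      using 1 s norm_mean_with_one_le_one[OF normZ(3)]
      by (intro mult_mono prod_le_1) (auto intro!: prod_nonneg power_le_one)
    finally show ?thesis by simp
  qed
  have g0: "g0 \<in> K" "v g0 = 1"
  proof -
    show "g0 \<in> K" by (auto simp: g0_def K_def)
    have "z ^ M * cnj z ^ M = 1" if "z \<in> Z" for z
      using normZ(1)[OF that] by (simp flip: power_mult_distrib complex_norm_square)
    then show "v g0 = 1" unfolding v_def g0_def by (intro prod.neutral) auto
  qed
  have "bb g0 = (real (2 * M choose M) / 4 ^ M) ^ r"
    by (simp add: bb_def g0_def b_def r_def)
  also have "\<dots> \<ge> (1 / (2 * real M)) ^ r"
    using central_binomial_lower_bound[OF M(2)] M(2)
    by (intro power_mono) (auto simp: field_simps)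
  finally have "1 / (2 * real M) ^ r \<le> bb g0" by (simp add: power_one_over)
  moreover have "2 * s ^ M < 1 / (2 * real M) ^ r"
    using M by (simp add: field_simps)
  ultimately have big: "2 * s ^ M < bb g0" by linarith
  \<comment> \<open>The coefficients of the other terms total at most 1, so with this value they can
    cancel at most half of the constant term.\<close>
  define \<delta> where "\<delta> = bb g0 / 2"
  have "0 < \<delta>" using big s by (simp add: \<delta>_def less_trans[OF _ big])
  obtain I :: "'i set" and m where I: "finite I" "I \<noteq> {}" "m ` I \<subseteq> D"
      "\<And>w. w \<in> v ` K - {1} \<Longrightarrow> norm (\<Sum>i\<in>I. w ^ m i) \<le> \<delta> * real (card I)"
  proof -
    have "finite (v ` K - {1})" "v ` K - {1} \<subseteq> unit_circle - {1}" using finK normv by auto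
    from avg[OF this \<open>0 < \<delta>\<close>] show thesis using that by blast
  qed
  have cI: "0 < real (card I)" using I by (simp add: card_gt_0_iff)
  define T where "T g = bb g * Re (cnj (h (v g)) * (\<Sum>i\<in>I. v g ^ m i))" for g
  have "(\<Sum>i\<in>I. P (m i)) = Re (\<Sum>i\<in>I. complex_of_real (P (m i)))" by simp
  also have "(\<Sum>i\<in>I. complex_of_real (P (m i)))
      = (\<Sum>g\<in>K. complex_of_real (bb g) * (cnj (h (v g)) * (\<Sum>i\<in>I. v g ^ m i)))"
    unfolding expand by (subst sum.swap) (simp add: sum_distrib_left mult_ac)
  also have "Re \<dots> = (\<Sum>g\<in>K. T g)" by (simp add: T_def)
  also have "\<dots> = T g0 + (\<Sum>g\<in>K - {g0}. T g)" using finK g0 by (intro sum.remove) auto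
  also have "T g0 = bb g0 * real (card I)" using circle_hom_one[OF h] by (simp add: T_def g0)
  finally have P_sum: "(\<Sum>i\<in>I. P (m i)) = bb g0 * real (card I) + (\<Sum>g\<in>K - {g0}. T g)" .
  have T_ge: "(\<Sum>g\<in>K - {g0}. T g) \<ge> (\<Sum>g\<in>K - {g0}. - (bb g * (\<delta> * real (card I))))"
  proof (intro sum_mono)
    fix g assume g: "g \<in> K - {g0}"
    have "- (\<delta> * real (card I)) \<le> Re (cnj (h (v g)) * (\<Sum>i\<in>I. v g ^ m i))"
    \<comment> \<open>Choices other than \<open>g0\<close> may also give \<open>v g = 1\<close>, but
      then \<open>h (v g) = 1\<close> and the term is nonnegative.\<close>
    proof (cases "v g = 1")
      case True
      have "0 \<le> \<delta> * real (card I)" using \<open>0 < \<delta>\<close> by simp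
      then show ?thesis unfolding True circle_hom_one[OF h] by simp
    next
      case False
      have "norm (cnj (h (v g)) * (\<Sum>i\<in>I. v g ^ m i)) \<le> \<delta> * real (card I)"
        using I(4)[of "v g"] g False norm_circle_hom[OF h normv] by (auto simp: norm_mult)
      then show ?thesis
        using abs_Re_le_cmod[of "cnj (h (v g)) * (\<Sum>i\<in>I. v g ^ m i)"] by linarith
    qed
    then have "bb g * - (\<delta> * real (card I)) \<le> T g"
      unfolding T_def using bb0 by (rule mult_left_mono)
    then show "- (bb g * (\<delta> * real (card I))) \<le> T g" by simp
  qed
  have "(\<Sum>g\<in>K - {g0}. - (bb g * (\<delta> * real (card I)))) = - ((\<Sum>g\<in>K - {g0}. bb g) * (\<delta> * real (card I)))"
    by (simp add: sum_negf sum_distrib_right)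
  also have "\<dots> \<ge> - (1 * (\<delta> * real (card I)))"
  proof -
    have "(\<Sum>g\<in>K - {g0}. bb g) \<le> 1"
      unfolding sum_bb[symmetric] using finK bb0 by (intro sum_mono2) auto
    then have "(\<Sum>g\<in>K - {g0}. bb g) * (\<delta> * real (card I)) \<le> 1 * (\<delta> * real (card I))"
      using \<open>0 < \<delta>\<close> by (intro mult_right_mono) auto
    then show ?thesis by simp
  qed
  finally have "bb g0 * real (card I) - \<delta> * real (card I) \<le> (\<Sum>i\<in>I. P (m i))"
    using T_ge unfolding P_sum by simp
  also have "\<dots> \<le> (\<Sum>i\<in>I. s ^ M)" using I P_le by (intro sum_mono) auto
  finally have "(bb g0 / 2) * real (card I) \<le> s ^ M * real (card I)"
    by (simp add: \<delta>_def field_simps)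
  then show False using cI big by (simp add: mult_le_cancel_right)
qed

text \<open>The sum over all subfamilies of \<open>Q\<close> factorises into the product of the
  \<open>1 + w ^ y q\<close>, which is the small product of means times the number of subfamilies.
  Since the long blocks grow in length, one of them contains \<open>N\<close> consecutive dyadic
  blocks, so all the sums lie in a single \<open>block_sums q l\<close>.\<close>

lemma block_sums_averages:
  assumes q: "strict_mono q" "filterlim (\<lambda>l. q (l + 1) - q l) at_top sequentially"
    and W: "finite W" "W \<subseteq> unit_circle - {1}" and "0 < \<delta>"
  shows "\<exists>(I :: nat set set) m. finite I \<and> I \<noteq> {} \<and> m ` I \<subseteq> (\<Union>l. block_sums q l) \<and>
        (\<forall>w\<in>W. norm (\<Sum>i\<in>I. w ^ m i) \<le> \<delta> * real (card I))"
proof -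
  obtain N where N: "\<And>a. a \<ge> 1 \<Longrightarrow> \<exists>G. (\<forall>q. G q \<subseteq> dyadic_block q) \<and>
    (\<forall>w\<in>W. norm (\<Prod>q\<in>{a..<a + N}. (1 + w ^ (\<Sum>j\<in>G q. erdos_taylor j)) / 2) < \<delta>)"
    using dyadic_block_means_small[OF W \<open>0 < \<delta>\<close>] by blast
  have "\<forall>\<^sub>F l in sequentially. N \<le> q (l + 1) - q l"
    using q(2) by (simp add: filterlim_at_top)
  \<comment> \<open>\<open>0 < l\<close> forces \<open>1 \<le> a\<close>, which keeps away from the
    dyadic block of index 0.\<close>
  then obtain l where l: "N \<le> q (l + 1) - q l" "0 < l"
    using eventually_happens[OF eventually_conj[OF _ eventually_gt_at_top[of 0]]] by force
  define a where "a = q l"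
  have "1 \<le> a" using strict_mono_imp_increasing[OF q(1), of l] l(2) by (simp add: a_def)
  then obtain G where G: "\<And>q. G q \<subseteq> dyadic_block q"
    "\<And>w. w \<in> W \<Longrightarrow> norm (\<Prod>q\<in>{a..<a + N}. (1 + w ^ (\<Sum>j\<in>G q. erdos_taylor j)) / 2) < \<delta>"
    using N[of a] by auto
  define y where "y q = (\<Sum>j\<in>G q. erdos_taylor j)" for q
  define Q where "Q = {a..<a + N}"
  have finG: "finite (G q)" for q using finite_subset[OF G(1)] by simp
  have disj: "G i \<inter> G j = {}" if "i \<noteq> j" for i j
  proof -
    have "dyadic_block i \<inter> dyadic_block j = {}" if "i < j" for i j
    proof -
      have "2 ^ (i + 1) \<le> (2 ^ j :: nat)" using that by (intro power_increasing) auto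
      then show ?thesis by (auto simp: dyadic_block_def)
    qed
    then have "dyadic_block i \<inter> dyadic_block j = {}"
      using \<open>i \<noteq> j\<close> by (metis inf_commute linorder_neqE_nat)
    then show ?thesis using G(1) by blast
  qed
  have "sum y B \<in> block_sums q l" if "B \<subseteq> Q" for B
  proof -
    have "sum y B = (\<Sum>j\<in>(\<Union>i\<in>B. G i). erdos_taylor j)"
      unfolding y_def using finG disj that finite_subset[of B Q]
      by (subst sum.UNION_disjoint) (auto simp: Q_def)
    moreover have "(\<Union>i\<in>B. G i) \<subseteq> long_block q l"
    proof -
      have "B \<subseteq> {q l..<q (l + 1)}" using that l(1) by (fastforce simp: Q_def a_def)
      then show ?thesis unfolding long_block_def using G(1) by (intro UN_mono)
    qed
    ultimately show ?thesis unfolding block_sums_def by blast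
  qed
  moreover have "norm (\<Sum>B\<in>Pow Q. w ^ sum y B) \<le> \<delta> * real (card (Pow Q))" if "w \<in> W" for w
  proof -
    have "(\<Sum>B\<in>Pow Q. w ^ sum y B) = (\<Prod>q\<in>Q. w ^ y q + 1)"
      by (subst prod_add) (auto simp: Q_def power_sum)
    also have "\<dots> = (\<Prod>q\<in>Q. (1 + w ^ y q) / 2) * of_nat (card (Pow Q))"
      by (simp add: prod_dividef card_Pow Q_def add.commute)
    finally have "norm (\<Sum>B\<in>Pow Q. w ^ sum y B) = norm (\<Prod>q\<in>Q. (1 + w ^ y q) / 2) * real (card (Pow Q))"
      by (simp only: norm_mult norm_of_nat)
    also have "\<dots> \<le> \<delta> * real (card (Pow Q))"
      using less_imp_le[OF G(2)[OF that]] unfolding y_def[symmetric] Q_def[symmetric]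
      by (intro mult_right_mono) auto
    finally show ?thesis .
  qed
  ultimately show ?thesis
    by (intro exI[of _ "Pow Q"] exI[of _ "sum y"]) (auto simp: Q_def)
qed

text \<open>A basic open set of the product topology constrains finitely many coordinates only;
  these form \<open>Z\<close>, and the smallest of the radii there serves as
  \<open>\<epsilon>\<close>.\<close>

lemma dense_in_bohr_if_approximable:
  fixes n :: "nat \<Rightarrow> int"
  assumes "\<And>h Z \<epsilon>. h \<in> circle_homs \<Longrightarrow> finite Z \<Longrightarrow> Z \<subseteq> unit_circle \<Longrightarrow> 0 < \<epsilon> \<Longrightarrow>
    \<exists>k. \<forall>z\<in>Z. norm (z powi n k - h z) < \<epsilon>"
  shows "dense_in_bohr n"
  unfolding dense_in_bohr_def
proof (intro equalityI closure_of_subset_topspace subsetI)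
  fix h assume "h \<in> topspace bohr_topology"
  then have h: "h \<in> circle_homs" by (simp add: topspace_bohr_topology)
  have "\<exists>k. int_char (n k) \<in> T" if T: "h \<in> T" "openin bohr_topology T" for T
  proof -
    obtain V where V: "openin (product_topology (\<lambda>_. top_of_set unit_circle) unit_circle) V"
        "T = V \<inter> circle_homs"
      using T(2) unfolding bohr_topology_def openin_subtopology by auto
    then obtain U where U: "finite {z \<in> unit_circle. U z \<noteq> unit_circle}"
        "\<And>z. z \<in> unit_circle \<Longrightarrow> openin (top_of_set unit_circle) (U z)"
        "h \<in> Pi\<^sub>E unit_circle U" "Pi\<^sub>E unit_circle U \<subseteq> V"
      using T(1) unfolding openin_product_topology_alt by fastforce
    define Z where "Z = {z \<in> unit_circle. U z \<noteq> unit_circle}"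
    have "\<exists>e>0. \<forall>x\<in>unit_circle. dist x (h z) < e \<longrightarrow> x \<in> U z" if "z \<in> unit_circle" for z
      using U(2)[OF that] U(3) that unfolding openin_euclidean_subtopology_iff by (auto simp: PiE_iff)
    then obtain e where e: "\<And>z. z \<in> unit_circle \<Longrightarrow> 0 < e z"
        "\<And>z x. z \<in> unit_circle \<Longrightarrow> x \<in> unit_circle \<Longrightarrow> dist x (h z) < e z \<Longrightarrow> x \<in> U z"
      by metis
    \<comment> \<open>The extra 1 keeps the minimum meaningful when \<open>Z\<close> is
      empty.\<close>
    define \<epsilon> where "\<epsilon> = Min (insert 1 (e ` Z))"
    have \<epsilon>: "0 < \<epsilon>" "\<And>z. z \<in> Z \<Longrightarrow> \<epsilon> \<le> e z"
      using U(1) e(1) unfolding \<epsilon>_def by (auto simp: Z_def)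
    obtain k where k: "\<And>z. z \<in> Z \<Longrightarrow> norm (z powi n k - h z) < \<epsilon>"
    proof -
      have "finite Z" "Z \<subseteq> unit_circle" using U(1) by (auto simp: Z_def)
      then show thesis using assms[of h Z \<epsilon>] h \<epsilon>(1) that by blast
    qed
    have "int_char (n k) \<in> Pi\<^sub>E unit_circle U"
    proof (rule PiE_I)
      fix z assume z: "z \<in> unit_circle"
      then have pow: "z powi n k \<in> unit_circle" by (simp add: norm_power_int)
      show "int_char (n k) z \<in> U z"
      proof (cases "z \<in> Z")
        case True
        then have "dist (z powi n k) (h z) < e z"
          using k[of z] \<epsilon>(2)[of z] by (simp add: dist_norm)
        then show ?thesis using e(2)[OF z pow] z by (simp add: int_char_def)
      next
        case False
        then show ?thesis using z pow by (simp add: Z_def int_char_def)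
      qed
    qed (simp add: int_char_def)
    then show ?thesis using U(4) V(2) int_char_in_circle_homs by blast
  qed
  then show "h \<in> bohr_topology closure_of range (\<lambda>k. int_char (n k))"
    using h by (auto simp: in_closure_of topspace_bohr_topology)
qed

lemma dense_in_bohr_enumerate_block_sums:
  assumes "strict_mono q" "filterlim (\<lambda>l. q (l + 1) - q l) at_top sequentially"
  shows "dense_in_bohr (\<lambda>k. int (enumerate (\<Union>l. block_sums q l) k))"
proof (rule dense_in_bohr_if_approximable)
  fix h and Z :: "complex set" and \<epsilon> :: real
  assume hZ: "h \<in> circle_homs" "finite Z" "Z \<subseteq> unit_circle" "0 < \<epsilon>"
  have "\<exists>m\<in>(\<Union>l. block_sums q l). \<forall>z\<in>Z. norm (z ^ m - h z) < \<epsilon>"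
    by (rule circle_hom_approximable[OF block_sums_averages[OF assms] hZ])
  then obtain m where m: "m \<in> (\<Union>l. block_sums q l)" "\<forall>z\<in>Z. norm (z ^ m - h z) < \<epsilon>"
    by (rule bexE)
  from enumerate_Ex[OF infinite_block_sums[OF assms(1)] m(1)]
  obtain k where "enumerate (\<Union>l. block_sums q l) k = m" by (rule exE)
  then show "\<exists>k. \<forall>z\<in>Z. norm (z powi int (enumerate (\<Union>l. block_sums q l) k) - h z) < \<epsilon>"
    using m(2) by (intro exI[of _ k]) (simp add: power_int_def)
qed

section \<open>A martingale of fractions\<close>

lemma erdos_taylor_pos: "0 < j \<Longrightarrow> 0 < erdos_taylor j"
  by (cases j rule: erdos_taylor.cases) auto

lemma erdos_taylor_Suc_ge: "j * erdos_taylor j \<le> erdos_taylor (Suc j)"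
  by (cases "j = 0") (auto simp: erdos_taylor_Suc)

lemma erdos_taylor_double: "2 \<le> j \<Longrightarrow> 2 * erdos_taylor j \<le> erdos_taylor (Suc j)"
  using erdos_taylor_Suc_ge[of j] mult_right_mono[of 2 j "erdos_taylor j"] by linarith

lemma erdos_taylor_ge_power: "2 ^ (k + 2) \<le> erdos_taylor (k + 3)"
proof (induction k)
  case (Suc k)
  then show ?case using erdos_taylor_double[of "k + 3"] by (simp add: add.commute)
qed (simp add: eval_nat_numeral)

text \<open>From index 2 on the terms at least double, so the last one dominates as in a geometric
  series.\<close>

lemma sum_erdos_taylor_le: "(\<Sum>j\<le>k + 2. erdos_taylor j) \<le> 2 * erdos_taylor (k + 2)"
proof (induction k)
  case (Suc k)
  then show ?case using erdos_taylor_double[of "k + 2"] by simp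
qed (simp add: numeral_2_eq_2)

lemma erdos_taylor_add3: "erdos_taylor (k + 3) = (k + 2) * erdos_taylor (k + 2) + 1"
  using erdos_taylor_Suc[of "k + 2"] by (simp add: eval_nat_numeral)

declare erdos_taylor.simps(3) [simp del]

text \<open>
  \<open>chain_law k\<close> is the law of the numerator \<open>A\<close> of the fraction \<open>t = A / p\<^sub>K\<close> at \<open>K = k + 2\<close>. A step
  replaces \<open>A\<close> by \<open>K A + m\<close> where \<open>m = 1\<close> with probability \<open>t\<close> and \<open>m = 0\<close> otherwise; it moves the fraction by
  \<open>(m - t) / p\<^sub>K\<^sub>+\<^sub>1\<close>, so that the fractions form a martingale.
\<close>

primrec chain_law :: "nat \<Rightarrow> nat pmf" where
  "chain_law 0 = return_pmf 1"
| "chain_law (Suc k) = chain_law k \<bind> (\<lambda>a. map_pmf (\<lambda>b. (k + 2) * a + of_bool b)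
      (bernoulli_pmf (real a / real (erdos_taylor (k + 2)))))"

definition chain_frac :: "nat \<Rightarrow> nat \<Rightarrow> real" where
  "chain_frac k a = real a / real (erdos_taylor (k + 2))"

lemma chain_law_Suc: "chain_law (Suc k) = chain_law k \<bind>
    (\<lambda>a. map_pmf (\<lambda>b. (k + 2) * a + of_bool b) (bernoulli_pmf (chain_frac k a)))"
  by (simp add: chain_frac_def)

declare chain_law.simps(2) [simp del]

lemma finite_set_chain_law: "finite (set_pmf (chain_law k))"
  by (induction k) (simp_all add: chain_law_Suc)

lemma chain_frac_step:
  "chain_frac (Suc k) ((k + 2) * a + of_bool b)
    = chain_frac k a + (of_bool b - chain_frac k a) / erdos_taylor (k + 3)"
proof -
  define p where "p = real (erdos_taylor (k + 2))"
  define p' where "p' = real (erdos_taylor (k + 3))"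
  have p': "p' = real (k + 2) * p + 1" by (simp add: p'_def p_def erdos_taylor_add3 algebra_simps)
  have "0 < p" using erdos_taylor_pos[of "k + 2"] by (simp add: p_def)
  then have "0 < p'" by (simp add: p' add_nonneg_pos)
  have "chain_frac (Suc k) ((k + 2) * a + of_bool b) = (real (k + 2) * real a + of_bool b) / p'"
    by (simp add: chain_frac_def p'_def eval_nat_numeral algebra_simps)
  also have "\<dots> = real a / p + (of_bool b - real a / p) / p'"
    using \<open>0 < p\<close> \<open>0 < p'\<close> by (simp add: field_simps) (simp add: p' algebra_simps)
  finally show ?thesis by (simp add: chain_frac_def p_def p'_def)
qed

text \<open>The chain starts at 1/2, and a step moves the fraction towards the bit with weight
  \<open>e\<close>, at most \<open>1 / 2 ^ (k + 2)\<close>. The slack of that size lets the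
  induction close: it halves in each step, and the released half pays for the move.\<close>

lemma chain_frac_bounds:
  assumes "a \<in> set_pmf (chain_law k)"
  shows "1 / 4 + 1 / 2 ^ (k + 2) \<le> chain_frac k a"
    and "chain_frac k a \<le> 3 / 4 - 1 / 2 ^ (k + 2)"
proof -
  have "\<bar>chain_frac k a - 1 / 2\<bar> \<le> 1 / 4 - 1 / 2 ^ (k + 2)"
    using assms
  proof (induction k arbitrary: a)
    case 0
    then show ?case by (simp add: chain_frac_def erdos_taylor_Suc numeral_2_eq_2)
  next
    case (Suc k)
    from Suc.prems obtain a' b where a': "a' \<in> set_pmf (chain_law k)" "a = (k + 2) * a' + of_bool b"
      unfolding chain_law_Suc set_bind_pmf set_map_pmf by blast
    define t where "t = chain_frac k a'"
    define e where "e = 1 / real (erdos_taylor (k + 3))"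
    define d :: real where "d = 1 / 2 ^ (k + 2)"
    have "real (2 ^ (k + 2)) \<le> real (erdos_taylor (k + 3))"
      using erdos_taylor_ge_power[of k] by (simp only: of_nat_le_iff)
    then have "1 / real (erdos_taylor (k + 3)) \<le> 1 / real (2 ^ (k + 2))"
      by (rule divide_left_mono) (use erdos_taylor_pos[of "k + 3"] in simp_all)
    then have e: "0 \<le> e" "e \<le> d"
      unfolding e_def d_def by simp_all
    have "(1::real) \<le> 2 ^ k" by simp
    then have d: "0 < d" "d \<le> 1 / 4" by (auto simp: d_def field_simps)
    have t: "\<bar>t - 1 / 2\<bar> \<le> 1 / 4 - d" unfolding t_def d_def using Suc.IH[OF a'(1)] .
    have "chain_frac (Suc k) a - 1 / 2 = (t - 1 / 2) * (1 - e) + (of_bool b - 1 / 2) * e"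
      unfolding a'(2) chain_frac_step t_def e_def by (simp add: algebra_simps diff_divide_distrib)
    also have "\<bar>\<dots>\<bar> \<le> \<bar>(t - 1 / 2) * (1 - e)\<bar> + \<bar>(of_bool b - 1 / 2) * e\<bar>"
      by (rule abs_triangle_ineq)
    also have "\<bar>(t - 1 / 2) * (1 - e)\<bar> \<le> (1 / 4 - d) * (1 - e)"
      using t e d by (subst abs_mult) (intro mult_mono; auto)
    also have "\<bar>(of_bool b - 1 / 2) * e\<bar> = e / 2"
      using e by (cases b) (auto simp: abs_mult)
    also have "(1 / 4 - d) * (1 - e) + e / 2 = 1 / 4 - d + e * (1 / 4 + d)"
      by (simp add: field_simps)
    also have "e * (1 / 4 + d) \<le> d * (1 / 2)"
      using e d by (intro mult_mono) auto
    finally show ?case by (simp add: d_def)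
  qed
  then show "1 / 4 + 1 / 2 ^ (k + 2) \<le> chain_frac k a" "chain_frac k a \<le> 3 / 4 - 1 / 2 ^ (k + 2)"
    by (auto simp: abs_le_iff)
qed

lemma chain_frac_in_unit:
  assumes "a \<in> set_pmf (chain_law k)"
  shows "1 / 4 \<le> chain_frac k a" "chain_frac k a \<le> 3 / 4"
proof -
  have "0 < 1 / (2::real) ^ (k + 2)" by simp
  then show "1 / 4 \<le> chain_frac k a" "chain_frac k a \<le> 3 / 4"
    using chain_frac_bounds[OF assms] by linarith+
qed

lemma integrable_chain_law: "integrable (measure_pmf (chain_law k)) (f :: nat \<Rightarrow> real)"
  by (rule integrable_measure_pmf_finite[OF finite_set_chain_law])

lemma expectation_chain_law_mono:
  fixes f g :: "nat \<Rightarrow> real"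
  assumes "\<And>a. a \<in> set_pmf (chain_law k) \<Longrightarrow> f a \<le> g a"
  shows "measure_pmf.expectation (chain_law k) f \<le> measure_pmf.expectation (chain_law k) g"
  using assms by (intro integral_mono_AE integrable_chain_law) (simp add: AE_measure_pmf_iff)

text \<open>Conditioning on the previous state reduces each later estimate from one stage to the
  next to a pointwise inequality.\<close>

lemma expectation_chain_law_Suc:
  fixes f :: "nat \<Rightarrow> real"
  shows "measure_pmf.expectation (chain_law (Suc k)) f = measure_pmf.expectation (chain_law k)
    (\<lambda>a. chain_frac k a * f ((k + 2) * a + 1) + (1 - chain_frac k a) * f ((k + 2) * a))"
proof -
  have "measure_pmf.expectation (chain_law (Suc k)) f = (\<Sum>a\<in>set_pmf (chain_law k). pmf (chain_law k) a *\<^sub>R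
      measure_pmf.expectation (map_pmf (\<lambda>b. (k + 2) * a + of_bool b) (bernoulli_pmf (chain_frac k a))) f)"
    unfolding chain_law_Suc by (rule pmf_expectation_bind) (auto simp: finite_set_chain_law)
  also have "\<dots> = (\<Sum>a\<in>set_pmf (chain_law k). pmf (chain_law k) a *\<^sub>R
      (chain_frac k a * f ((k + 2) * a + 1) + (1 - chain_frac k a) * f ((k + 2) * a)))"
  proof (intro sum.cong refl)
    fix a assume "a \<in> set_pmf (chain_law k)"
    \<comment> \<open>\<open>bernoulli_pmf\<close> truncates its parameter to the unit interval, so
      the formula for its expectation needs these bounds.\<close>
    then have "0 \<le> chain_frac k a" "chain_frac k a \<le> 1" using chain_frac_in_unit[of a k] by auto
    then show "pmf (chain_law k) a *\<^sub>R
      measure_pmf.expectation (map_pmf (\<lambda>b. (k + 2) * a + of_bool b) (bernoulli_pmf (chain_frac k a))) f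
      = pmf (chain_law k) a *\<^sub>R
      (chain_frac k a * f ((k + 2) * a + 1) + (1 - chain_frac k a) * f ((k + 2) * a))"
      by (simp add: algebra_simps)
  qed
  also have "\<dots> = measure_pmf.expectation (chain_law k)
    (\<lambda>a. chain_frac k a * f ((k + 2) * a + 1) + (1 - chain_frac k a) * f ((k + 2) * a))"
    by (rule integral_measure_pmf[symmetric]) (auto simp: finite_set_chain_law)
  finally show ?thesis .
qed

text \<open>The bit is smaller than \<open>k + 2\<close>, so \<open>c div (k + 2)\<close> is the
  only possible predecessor of \<open>c\<close>, and either bit has conditional probability at most
  3/4.\<close>

lemma pmf_chain_law_le: "pmf (chain_law k) c \<le> (3 / 4) ^ k"
proof (induction k arbitrary: c)
  case (Suc k)
  have pmf_eq: "pmf (chain_law k) c = measure_pmf.expectation (chain_law k) (indicator {c})" for k c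
    by (simp add: pmf.rep_eq)
  have "pmf (chain_law (Suc k)) c \<le> measure_pmf.expectation (chain_law k)
      (\<lambda>a. 3 / 4 * indicator {c div (k + 2)} a)"
    unfolding pmf_eq expectation_chain_law_Suc
  proof (rule expectation_chain_law_mono)
    fix a assume a: "a \<in> set_pmf (chain_law k)"
    have "((k + 2) * a + 1) div (k + 2) = a" "((k + 2) * a) div (k + 2) = a"
      by (simp_all only: div_mult_self4 div_mult_self1_is_m) auto
    then show "chain_frac k a * indicator {c} ((k + 2) * a + 1) + (1 - chain_frac k a) * indicator {c} ((k + 2) * a)
      \<le> 3 / 4 * indicator {c div (k + 2)} a"
      using chain_frac_in_unit[OF a] by (auto simp: indicator_def)
  qed
  also have "\<dots> = 3 / 4 * pmf (chain_law k) (c div (k + 2))" by (simp add: pmf_eq)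
  also have "\<dots> \<le> 3 / 4 * (3 / 4) ^ k" using Suc.IH by (intro mult_left_mono) auto
  finally show ?case by simp
qed (simp add: pmf_le_1)

section \<open>Second moments of the deviations\<close>

definition part_sum :: "nat set \<Rightarrow> nat \<Rightarrow> nat" where
  "part_sum F K = (\<Sum>j\<in>F \<inter> {..K}. erdos_taylor j)"

lemma part_sum_Suc: "part_sum F (Suc K) = part_sum F K + (if Suc K \<in> F then erdos_taylor (Suc K) else 0)"
proof -
  have "F \<inter> {..Suc K} = F \<inter> {..K} \<union> (if Suc K \<in> F then {Suc K} else {})"
    by (auto simp: le_Suc_eq)
  then show ?thesis by (simp add: part_sum_def)
qed

text \<open>This ratio scales the random bit in the increment of \<open>part_dev\<close>; its decay
  makes the squares summable over the stages.\<close>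

lemma part_sum_ratio_le: "real (part_sum F (k + 2)) / real (erdos_taylor (k + 3)) \<le> 2 / real (k + 2)"
proof -
  have "part_sum F (k + 2) \<le> (\<Sum>j\<le>k + 2. erdos_taylor j)"
    unfolding part_sum_def by (intro sum_mono2) auto
  also have "\<dots> \<le> 2 * erdos_taylor (k + 2)" by (rule sum_erdos_taylor_le)
  finally have "(k + 2) * part_sum F (k + 2) \<le> (k + 2) * (2 * erdos_taylor (k + 2))"
    by (rule mult_le_mono2)
  also have "\<dots> \<le> 2 * erdos_taylor (k + 3)"
    by (simp add: erdos_taylor_add3 algebra_simps)
  finally have "real ((k + 2) * part_sum F (k + 2)) \<le> real (2 * erdos_taylor (k + 3))"
    by (simp only: of_nat_le_iff)
  moreover have "0 < real (erdos_taylor (k + 3))" using erdos_taylor_pos[of "k + 3"] by simp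
  ultimately show ?thesis by (simp add: field_simps)
qed

text \<open>
  If \<open>t\<^sub>j\<close> denotes the fraction at stage \<open>j\<close>, then \<open>part_dev F k a\<close> is the sum of \<open>p\<^sub>j (t\<^sub>K - t\<^sub>j)\<close> over
  \<open>j \<in> F\<close> with \<open>j \<le> K = k + 2\<close>; the history of the chain is recovered from \<open>a\<close> by successive divisions.
\<close>

primrec part_dev :: "nat set \<Rightarrow> nat \<Rightarrow> nat \<Rightarrow> real" where
  "part_dev F 0 a = 0"
| "part_dev F (Suc k) a = part_dev F k (a div (k + 2)) +
    real (part_sum F (k + 2)) * (chain_frac (Suc k) a - chain_frac k (a div (k + 2)))"

declare part_dev.simps(2) [simp del]

text \<open>From one stage to the next the expression changes only when the new index
  \<open>j\<close> lies in \<open>F\<close>, and then by \<open>p\<^sub>j t\<^sub>j\<close>, which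
  is the integer numerator. The start is zero because \<open>F\<close> has no index up to 2.\<close>

lemma part_dev_congruent:
  assumes "F \<subseteq> {2<..}"
  shows "real (part_sum F (k + 2)) * chain_frac k a - part_dev F k a \<in> \<int>"
proof (induction k arbitrary: a)
  case 0
  have "F \<inter> {..0 + 2} = {}" using assms by auto
  then show ?case unfolding part_sum_def by simp
next
  case (Suc k)
  let ?t = "chain_frac (Suc k) a"
  have "real (erdos_taylor (k + 3)) * ?t = real a"
    using erdos_taylor_pos[of "k + 3"] by (simp add: chain_frac_def eval_nat_numeral)
  then have "real (part_sum F (Suc (k + 2))) * ?t - real (part_sum F (k + 2)) * ?t \<in> \<int>"
    unfolding part_sum_Suc by (auto simp: eval_nat_numeral algebra_simps)
  from Ints_add[OF this Suc.IH[of "a div (k + 2)"]]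
  show ?case by (simp add: part_dev.simps(2) algebra_simps)
qed

text \<open>Given the previous state, the increment is \<open>c\<close> times a centred bit: the
  cross term vanishes and the variance \<open>c\<^sup>2 * t * (1 - t)\<close> is at most
  \<open>c\<^sup>2 / 4\<close>.\<close>

lemma part_dev_second_moment_Suc:
  "measure_pmf.expectation (chain_law (Suc k)) (\<lambda>a. (part_dev F (Suc k) a)\<^sup>2)
    \<le> measure_pmf.expectation (chain_law k) (\<lambda>a. (part_dev F k a)\<^sup>2)
      + (real (part_sum F (k + 2)) / real (erdos_taylor (k + 3)))\<^sup>2 / 4"
proof -
  define c where "c = real (part_sum F (k + 2)) / real (erdos_taylor (k + 3))"
  have "measure_pmf.expectation (chain_law (Suc k)) (\<lambda>a. (part_dev F (Suc k) a)\<^sup>2)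
    \<le> measure_pmf.expectation (chain_law k) (\<lambda>a. (part_dev F k a)\<^sup>2 + c\<^sup>2 / 4)"
    unfolding expectation_chain_law_Suc
  proof (rule expectation_chain_law_mono)
    fix a
    define t where "t = chain_frac k a"
    define s where "s = part_dev F k a"
    have dv: "((k + 2) * a + of_bool b) div (k + 2) = a" for b
      by (cases b) (simp_all only: of_bool_eq div_mult_self4 div_mult_self1_is_m, auto)
    have dev: "part_dev F (Suc k) ((k + 2) * a + of_bool b) = s + c * (of_bool b - t)" for b
      unfolding part_dev.simps dv chain_frac_step s_def t_def c_def by (simp add: algebra_simps)
    have "t * (part_dev F (Suc k) ((k + 2) * a + 1))\<^sup>2 + (1 - t) * (part_dev F (Suc k) ((k + 2) * a))\<^sup>2
      = t * (s + c * (1 - t))\<^sup>2 + (1 - t) * (s + c * (0 - t))\<^sup>2"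
      using dev[of True] dev[of False] by simp
    also have "\<dots> = s\<^sup>2 + c\<^sup>2 / 4 - c\<^sup>2 * (t - 1 / 2)\<^sup>2"
      by (simp add: power2_eq_square field_simps)
    also have "\<dots> \<le> s\<^sup>2 + c\<^sup>2 / 4" by simp
    finally show "chain_frac k a * (part_dev F (Suc k) ((k + 2) * a + 1))\<^sup>2
      + (1 - chain_frac k a) * (part_dev F (Suc k) ((k + 2) * a))\<^sup>2 \<le> (part_dev F k a)\<^sup>2 + c\<^sup>2 / 4"
      by (simp only: t_def s_def)
  qed
  also have "\<dots> = measure_pmf.expectation (chain_law k) (\<lambda>a. (part_dev F k a)\<^sup>2) + c\<^sup>2 / 4"
    using integrable_chain_law by (subst Bochner_Integration.integral_add) auto
  finally show ?thesis by (simp add: c_def)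
qed

text \<open>Nothing accumulates while the partial sums are empty; afterwards each stage adds at most
  \<open>1 / real (k + 1) - 1 / real (k + 2)\<close>, which telescopes.\<close>

lemma part_dev_second_moment_le:
  assumes F: "F \<subseteq> {m<..}" and m: "2 \<le> m"
  shows "measure_pmf.expectation (chain_law k) (\<lambda>a. (part_dev F k a)\<^sup>2)
    \<le> (if k + 2 \<le> m then 0 else 1 / real m - 1 / real (k + 1))"
proof (induction k)
  case 0
  then show ?case using m by simp
next
  case (Suc k)
  define c where "c = real (part_sum F (k + 2)) / real (erdos_taylor (k + 3))"
  note step = part_dev_second_moment_Suc[of k F, folded c_def]
  show ?case
  proof (cases "k + 2 \<le> m")
    case True
    then have "F \<inter> {..k + 2} = {}" using F by auto
    then have "c = 0" by (simp add: c_def part_sum_def)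
    then have "measure_pmf.expectation (chain_law (Suc k)) (\<lambda>a. (part_dev F (Suc k) a)\<^sup>2) \<le> 0"
      using step Suc.IH True by simp
    \<comment> \<open>At the stage where the second branch of the bound takes over, its value is
      still 0.\<close>
    moreover have "real m = real (k + 2)" if "\<not> Suc k + 2 \<le> m" using that True by linarith
    ultimately show ?thesis by auto
  next
    case False
    have "c\<^sup>2 \<le> (2 / real (k + 2))\<^sup>2"
      unfolding c_def by (intro power_mono part_sum_ratio_le) simp
    then have "c\<^sup>2 / 4 \<le> 1 / (real (k + 2) * real (k + 2))" by (simp add: power2_eq_square)
    also have "\<dots> \<le> 1 / (real (k + 1) * real (k + 2))"
      by (intro divide_left_mono mult_right_mono) auto
    also have "\<dots> = 1 / real (k + 1) - 1 / real (k + 2)" by (simp add: field_simps)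
    finally show ?thesis using step Suc.IH False by simp
  qed
qed

lemma one_minus_cos_le: "1 - cos x \<le> x\<^sup>2 / 2" for x :: real
proof -
  have "1 - cos x = 2 * (sin (x / 2))\<^sup>2"
    using cos_double_sin[of "x / 2"] by simp
  also have "(sin (x / 2))\<^sup>2 \<le> (x / 2)\<^sup>2"
    using abs_sin_x_le_abs_x[of "x / 2"] by (rule iffD1[OF abs_le_square_iff])
  finally show ?thesis by (simp add: power_divide)
qed

text \<open>Modulo 1 the argument divided by \<open>2 * pi\<close> equals the deviation, whose
  second moment is at most \<open>1 / real m\<close>; the quadratic bound for the cosine does the
  rest. The estimate is uniform in \<open>k\<close> and in the size of \<open>F\<close>.\<close>

lemma expectation_cos_chain_law_ge:
  assumes F: "F \<subseteq> {m<..k + 2}" and m: "2 \<le> m"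
  shows "1 - 2 * pi\<^sup>2 / real m \<le> measure_pmf.expectation (chain_law k)
    (\<lambda>a. cos (2 * pi * real (\<Sum>j\<in>F. erdos_taylor j) * chain_frac k a))"
proof -
  have "F \<inter> {..k + 2} = F" using F by auto
  then have psum: "part_sum F (k + 2) = (\<Sum>j\<in>F. erdos_taylor j)" by (simp add: part_sum_def)
  have "F \<subseteq> {m<..}" using F by auto
  from part_dev_second_moment_le[OF this m, of k]
  have "measure_pmf.expectation (chain_law k) (\<lambda>a. (part_dev F k a)\<^sup>2) \<le> 1 / real m"
    by (rule order.trans) simp
  then have "1 - 2 * pi\<^sup>2 / real m
      \<le> 1 - 2 * pi\<^sup>2 * measure_pmf.expectation (chain_law k) (\<lambda>a. (part_dev F k a)\<^sup>2)"
    using mult_left_mono[of _ "1 / real m" "2 * pi\<^sup>2"] by simp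
  also have "\<dots> = measure_pmf.expectation (chain_law k) (\<lambda>a. 1 - 2 * pi\<^sup>2 * (part_dev F k a)\<^sup>2)"
    using integrable_chain_law by (subst Bochner_Integration.integral_diff) auto
  also have "\<dots> \<le> measure_pmf.expectation (chain_law k)
    (\<lambda>a. cos (2 * pi * real (\<Sum>j\<in>F. erdos_taylor j) * chain_frac k a))"
  proof (rule expectation_chain_law_mono)
    fix a
    have "F \<subseteq> {2<..}" using F m by auto
    from part_dev_congruent[OF this, of k a]
    obtain i :: int where i: "real (part_sum F (k + 2)) * chain_frac k a - part_dev F k a = of_int i"
      by (auto elim: Ints_cases)
    have "cos (2 * pi * real (\<Sum>j\<in>F. erdos_taylor j) * chain_frac k a)
        = cos (2 * pi * part_dev F k a + 2 * pi * of_int i)"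
      unfolding psum[symmetric] i[symmetric] by (simp add: algebra_simps)
    also have "\<dots> = cos (2 * pi * part_dev F k a)"
      by (simp add: cos_add)
    finally show "1 - 2 * pi\<^sup>2 * (part_dev F k a)\<^sup>2
        \<le> cos (2 * pi * real (\<Sum>j\<in>F. erdos_taylor j) * chain_frac k a)"
      using one_minus_cos_le[of "2 * pi * part_dev F k a"] by (simp add: power_mult_distrib)
  qed
  finally show ?thesis .
qed

section \<open>Absence of atoms and passage to the limit\<close>

lemma expectation_indicator_pmf: "measure_pmf.expectation p (indicator A :: 'a \<Rightarrow> real) = measure p A"
  by simp

text \<open>Since \<open>p\<close> at least doubles, the radius shrinks in each step by at least the
  largest possible move of the fraction. Hence a state in the window can only come from a state in
  the previous window.\<close>

lemma chain_window_decreasing: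
  fixes x \<delta> :: real
  defines "w \<equiv> \<lambda>k. {a. \<bar>chain_frac k a - x\<bar> < \<delta> + 2 / real (erdos_taylor (k + 3))}"
  assumes "j \<le> k"
  shows "measure (chain_law k) (w k) \<le> measure (chain_law j) (w j)"
  using assms(2)
proof (induction rule: dec_induct)
  case (step k)
  have "measure_pmf.expectation (chain_law (Suc k)) (indicator (w (Suc k)) :: nat \<Rightarrow> real)
      \<le> measure_pmf.expectation (chain_law k) (indicator (w k))"
    unfolding expectation_chain_law_Suc
  proof (rule expectation_chain_law_mono)
    fix a assume "a \<in> set_pmf (chain_law k)"
    then have t: "0 \<le> chain_frac k a" "chain_frac k a \<le> 1" using chain_frac_in_unit[of a k] by auto
    define p where "p = real (erdos_taylor (k + 3))"
    define p' where "p' = real (erdos_taylor (Suc k + 3))"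
    have "2 * erdos_taylor (k + 3) \<le> erdos_taylor (Suc k + 3)"
      using erdos_taylor_double[of "k + 3"] by simp
    then have "real (2 * erdos_taylor (k + 3)) \<le> p'"
      unfolding p'_def by (simp only: of_nat_le_iff)
    then have "2 * p \<le> p'" by (simp add: p_def)
    moreover have "0 < p" using erdos_taylor_pos[of "k + 3"] by (simp add: p_def)
    ultimately have e: "2 / p' \<le> 1 / p" by (simp add: field_simps)
    have in_w: "a \<in> w k" if "(k + 2) * a + of_bool b \<in> w (Suc k)" for b
    proof -
      define d where "d = (of_bool b - chain_frac k a) / p"
      have "\<bar>of_bool b - chain_frac k a\<bar> \<le> 1" using t by (cases b) simp_all
      then have d: "\<bar>d\<bar> \<le> 1 / p"
        unfolding d_def abs_divide using \<open>0 < p\<close> by (simp add: divide_right_mono)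
      have "\<bar>chain_frac k a + d - x\<bar> < \<delta> + 2 / p'"
        using that unfolding w_def mem_Collect_eq chain_frac_step d_def p_def p'_def .
      then have "\<bar>chain_frac k a - x\<bar> < \<delta> + (2 / p' + 1 / p)"
        using d by linarith
      also have "\<dots> \<le> \<delta> + 2 / p" using e by simp
      finally show ?thesis unfolding w_def p_def by simp
    qed
    have ind: "indicator (w (Suc k)) ((k + 2) * a + of_bool b) \<le> (indicator (w k) a :: real)" for b
    proof (cases "(k + 2) * a + of_bool b \<in> w (Suc k)")
      case True
      then show ?thesis using in_w[OF True] by (simp only: indicator_simps order.refl)
    next
      case False
      then show ?thesis by (simp only: indicator_simps(2) indicator_pos_le not_False_eq_True)
    qed
    have convex: "s * u + (1 - s) * v \<le> c" if "u \<le> c" "v \<le> c" "0 \<le> s" "s \<le> 1" for s u v c :: real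
      using convex_bound_le[of u c v s "1 - s"] that by simp
    show "chain_frac k a * indicator (w (Suc k)) ((k + 2) * a + 1)
        + (1 - chain_frac k a) * indicator (w (Suc k)) ((k + 2) * a) \<le> indicator (w k) a"
      using ind[of True] ind[of False] t by (intro convex) (simp_all only: of_bool_eq add_0_right)
  qed
  then have "measure (chain_law (Suc k)) (w (Suc k)) \<le> measure (chain_law k) (w k)"
    unfolding expectation_indicator_pmf .
  then show ?case using step.IH by (rule order.trans)
qed (rule order.refl)

text \<open>It suffices to look at stage \<open>j\<close>, where the fractions lie on a grid and the
  window is too short to hold two grid points. The bound is uniform in the later stages and so
  survives the limit.\<close>

lemma chain_law_small_windows:
  assumes "5 \<le> j"
  shows "\<exists>\<delta>>0. \<forall>k\<ge>j. measure (chain_law k) {a. \<bar>chain_frac k a - x\<bar> < \<delta>} \<le> (3 / 4) ^ j"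
proof -
  define p where "p = real (erdos_taylor (j + 2))"
  define p' where "p' = real (erdos_taylor (j + 3))"
  \<comment> \<open>In units of the grid spacing \<open>1 / p\<close> the window radius is at most
    1/8 + 2/7 = 23/56 < 1/2; the 2/7 comes from \<open>7 * p \<le> p'\<close>, which needs
    \<open>5 \<le> j\<close>.\<close>
  define \<delta> where "\<delta> = 1 / (8 * p)"
  have p: "0 < p" using erdos_taylor_pos[of "j + 2"] by (simp add: p_def)
  have "p' = real (j + 2) * p + 1" by (simp add: p'_def p_def erdos_taylor_add3 algebra_simps)
  moreover have "7 * p \<le> real (j + 2) * p" using assms p by (intro mult_right_mono) auto
  ultimately have p': "7 * p \<le> p'" by linarith
  then have "2 / p' * p \<le> 2 / 7" using p by (simp add: field_simps)
  moreover have "\<delta> * p = 1 / 8" using p by (simp add: \<delta>_def)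
  ultimately have width: "(\<delta> + 2 / p') * p \<le> 23 / 56"
    unfolding distrib_right by linarith
  define w where "w k = {a. \<bar>chain_frac k a - x\<bar> < \<delta> + 2 / real (erdos_taylor (k + 3))}" for k
  have close: "\<bar>real a - x * p\<bar> < 23 / 56" if "a \<in> w j" for a
  proof -
    have "real a - x * p = (chain_frac j a - x) * p"
      using p unfolding chain_frac_def p_def[symmetric] by (simp add: algebra_simps)
    then have "\<bar>real a - x * p\<bar> = \<bar>chain_frac j a - x\<bar> * p" using p by (simp add: abs_mult)
    also have "\<dots> < (\<delta> + 2 / p') * p"
      using that p by (intro mult_strict_right_mono) (auto simp: w_def p'_def)
    finally show ?thesis using width by linarith
  qed
  have uniq: "a = b" if "a \<in> w j" "b \<in> w j" for a b
  proof -
    have "\<bar>real a - real b\<bar> < 1" using close[OF that(1)] close[OF that(2)] by linarith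
    then show ?thesis by linarith
  qed
  have wj: "measure (chain_law j) (w j) \<le> (3 / 4) ^ j"
  proof (cases "w j = {}")
    case False
    then obtain a where "w j = {a}" using uniq by blast
    then show ?thesis using pmf_chain_law_le[of j a] by (simp add: pmf.rep_eq)
  qed simp
  have "measure (chain_law k) {a. \<bar>chain_frac k a - x\<bar> < \<delta>} \<le> (3 / 4) ^ j" if "j \<le> k" for k
  proof -
    have "{a. \<bar>chain_frac k a - x\<bar> < \<delta>} \<subseteq> w k"
      unfolding w_def by (auto intro: less_le_trans)
    then have "measure (chain_law k) {a. \<bar>chain_frac k a - x\<bar> < \<delta>} \<le> measure (chain_law k) (w k)"
      by (intro measure_pmf.finite_measure_mono) auto
    also have "\<dots> \<le> measure (chain_law j) (w j)"
      unfolding w_def by (rule chain_window_decreasing[OF that])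
    finally show ?thesis using wj by linarith
  qed
  then show ?thesis using p by (intro exI[of _ \<delta>]) (auto simp: \<delta>_def)
qed

text \<open>The laws of the fractions live on a bounded interval, so weak compactness gives a limit
  along a subsequence \<open>r\<close>, without realising the whole chain on one probability space.
  Both properties pass to the limit by testing with bounded continuous functions.\<close>

lemma exists_limit_distribution:
  "\<exists>M. real_distribution M \<and> (\<forall>x. measure M {x} = 0) \<and>
    (\<forall>m F. 2 \<le> m \<longrightarrow> finite F \<longrightarrow> F \<subseteq> {m<..} \<longrightarrow>
      1 - 2 * pi\<^sup>2 / real m \<le> (LINT x|M. cos (2 * pi * real (\<Sum>j\<in>F. erdos_taylor j) * x)))"
proof -
  define \<mu> where "\<mu> k = distr (measure_pmf (chain_law k)) borel (chain_frac k)" for k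
  have rd: "real_distribution (\<mu> k)" for k
    unfolding \<mu>_def by (intro prob_space.real_distribution_distr measure_pmf.prob_space_axioms) simp
  have int_\<mu>: "(LINT x|\<mu> k. f x) = measure_pmf.expectation (chain_law k) (\<lambda>a. f (chain_frac k a))"
    if "f \<in> borel_measurable borel" for f :: "real \<Rightarrow> real" and k
    unfolding \<mu>_def using that by (intro integral_distr) auto
  have "measure (\<mu> k) {0<..1} = 1" for k
  proof -
    have "measure (\<mu> k) {0<..1} = measure (chain_law k) (chain_frac k -` {0<..1})"
      unfolding \<mu>_def by (subst measure_distr) auto
    also have "\<dots> = 1"
      using chain_frac_in_unit[of _ k] by (subst measure_pmf.prob_eq_1) (force simp: AE_measure_pmf_iff)+
    finally show ?thesis .
  qed
  then have "tight \<mu>"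
    unfolding tight_def using rd by (intro conjI allI impI exI[of _ "0::real"] exI[of _ "1::real"]) simp_all
  then obtain r M where M: "strict_mono r" "real_distribution M" "weak_conv_m (\<mu> \<circ> id \<circ> r) M"
    using tight_imp_convergent_subsubsequence[of \<mu> id] strict_mono_id by blast
  interpret M: real_distribution M by fact
  have conv: "(\<lambda>k. measure_pmf.expectation (chain_law (r k)) (\<lambda>a. f (chain_frac (r k) a))) \<longlonglongrightarrow> (LINT x|M. f x)"
    if f: "\<And>x. isCont f x" "\<And>x. norm (f x) \<le> 1" for f :: "real \<Rightarrow> real"
  proof -
    have "(\<lambda>k. LINT x|\<mu> (r k). f x) \<longlonglongrightarrow> (LINT x|M. f x)"
      using weak_conv_imp_integral_bdd_continuous_conv[of "\<mu> \<circ> id \<circ> r" M f 1] rd M f by simp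
    moreover have "f \<in> borel_measurable borel"
      using f(1) by (intro borel_measurable_continuous_onI continuous_at_imp_continuous_on) auto
    ultimately show ?thesis by (simp add: int_\<mu>)
  qed
  have r_ge: "k \<le> r k" for k using strict_mono_imp_increasing[OF M(1)] .
  have "measure M {x} = 0" for x
  proof -
    have "measure M {x} \<le> (3 / 4) ^ j" if "5 \<le> j" for j
    proof -
      obtain \<delta> where \<delta>: "0 < \<delta>" "\<And>k. j \<le> k \<Longrightarrow> measure (chain_law k) {a. \<bar>chain_frac k a - x\<bar> < \<delta>} \<le> (3 / 4) ^ j"
        using chain_law_small_windows[OF \<open>5 \<le> j\<close>] by blast
      \<comment> \<open>A continuous tent lying between the indicators of \<open>{x}\<close> and of
        the window of radius \<open>\<delta>\<close>.\<close>
      define f where "f y = max 0 (1 - \<bar>y - x\<bar> / \<delta>)" for y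
      have cont: "isCont f y" for y unfolding f_def using \<delta>(1) by (intro continuous_intros) auto
      have f01: "0 \<le> f y" "f y \<le> 1" for y unfolding f_def using \<delta>(1) by auto
      have meas: "f \<in> borel_measurable borel"
        using cont by (intro borel_measurable_continuous_onI continuous_at_imp_continuous_on) auto
      have "measure M {x} = (LINT y|M. indicator {x} y)" by simp
      also have "\<dots> \<le> (LINT y|M. f y)"
      proof (rule integral_mono)
        show "integrable M (indicator {x} :: real \<Rightarrow> real)"
          by (intro M.integrable_const_bound[where B = 1]) (auto simp: indicator_def)
        show "integrable M f"
          using f01 meas by (intro M.integrable_const_bound[where B = 1]) auto
        show "indicator {x} y \<le> f y" for y using f01[of y] by (auto simp: indicator_def f_def)
      qed
      also have "\<dots> \<le> (3 / 4) ^ j"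
      proof (rule LIMSEQ_le_const2[OF conv])
        show "norm (f y) \<le> 1" for y using f01[of y] by simp
        show "\<exists>N. \<forall>k\<ge>N. measure_pmf.expectation (chain_law (r k)) (\<lambda>a. f (chain_frac (r k) a)) \<le> (3 / 4) ^ j"
        proof (intro exI[of _ j] allI impI)
          fix k assume "j \<le> k"
          have "measure_pmf.expectation (chain_law (r k)) (\<lambda>a. f (chain_frac (r k) a))
            \<le> measure_pmf.expectation (chain_law (r k)) (indicator {a. \<bar>chain_frac (r k) a - x\<bar> < \<delta>})"
          proof (rule expectation_chain_law_mono)
            fix a
            show "f (chain_frac (r k) a) \<le> indicator {a. \<bar>chain_frac (r k) a - x\<bar> < \<delta>} a"
              using f01[of "chain_frac (r k) a"] \<delta>(1)
              by (auto simp: indicator_def f_def field_simps split: if_splits)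
          qed
          also have "\<dots> = measure (chain_law (r k)) {a. \<bar>chain_frac (r k) a - x\<bar> < \<delta>}" by simp
          also have "\<dots> \<le> (3 / 4) ^ j"
            using \<open>j \<le> k\<close> r_ge[of k] by (intro \<delta>(2)) linarith
          finally show "measure_pmf.expectation (chain_law (r k)) (\<lambda>a. f (chain_frac (r k) a)) \<le> (3 / 4) ^ j" .
        qed
      qed (rule cont)
      finally show ?thesis .
    qed
    moreover have "(\<lambda>j. (3 / 4 :: real) ^ j) \<longlonglongrightarrow> 0" by (intro LIMSEQ_realpow_zero) auto
    ultimately have "measure M {x} \<le> 0" by (intro LIMSEQ_le_const) auto
    then show ?thesis by (simp add: measure_le_0_iff)
  qed
  moreover have "1 - 2 * pi\<^sup>2 / real m \<le> (LINT x|M. cos (2 * pi * real (\<Sum>j\<in>F. erdos_taylor j) * x))"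
    if F: "2 \<le> m" "finite F" "F \<subseteq> {m<..}" for m F
  proof (rule LIMSEQ_le_const[OF conv])
    obtain N where N: "\<And>j. j \<in> F \<Longrightarrow> j \<le> N" using F(2) finite_nat_set_iff_bounded_le by auto
    show "\<exists>N. \<forall>k\<ge>N. 1 - 2 * pi\<^sup>2 / real m \<le> measure_pmf.expectation (chain_law (r k))
        (\<lambda>a. cos (2 * pi * real (\<Sum>j\<in>F. erdos_taylor j) * chain_frac (r k) a))"
    proof (intro exI[of _ N] allI impI)
      fix k assume "N \<le> k"
      then have "F \<subseteq> {m<..r k + 2}" using F(3) N r_ge[of k] by fastforce
      then show "1 - 2 * pi\<^sup>2 / real m \<le> measure_pmf.expectation (chain_law (r k))
        (\<lambda>a. cos (2 * pi * real (\<Sum>j\<in>F. erdos_taylor j) * chain_frac (r k) a))"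
        using F(1) by (rule expectation_cos_chain_law_ge)
    qed
  qed (auto intro!: continuous_intros)
  ultimately show ?thesis using M(2) by blast
qed

section \<open>Transport to the circle and rigidity\<close>

lemma finite_long_block: "finite (long_block q l)"
  by (simp add: long_block_def)

lemma finite_block_sums: "finite (block_sums q l)"
proof -
  have "block_sums q l = (\<lambda>F. \<Sum>j\<in>F. erdos_taylor j) ` Pow (long_block q l)"
    by (auto simp: block_sums_def)
  then show ?thesis by (simp add: finite_long_block)
qed

lemma long_block_subset:
  assumes "strict_mono q" "m \<le> l"
  shows "long_block q l \<subseteq> {m<..}"
proof
  fix j assume "j \<in> long_block q l"
  then obtain i where "q l \<le> i" "2 ^ i < j" by (auto simp: long_block_def dyadic_block_def)
  then show "j \<in> {m<..}"
    using assms(2) strict_mono_imp_increasing[OF assms(1), of l] less_exp[of i]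
    unfolding greaterThan_iff by linarith
qed

text \<open>The limit law is pushed forward along \<open>e\<close>. The real part of the coefficient
  at \<open>n\<close> is the cosine integral, and a number of norm at most 1 whose real part is
  close to 1 is itself close to 1.\<close>

lemma rigidity_sequence_enumerate_block_sums:
  assumes q: "strict_mono q"
  shows "rigidity_sequence (\<lambda>k. int (enumerate (\<Union>l. block_sums q l) k))"
proof -
  define D where "D = (\<Union>l. block_sums q l)"
  have infD: "infinite D" unfolding D_def by (rule infinite_block_sums[OF q])
  obtain M where M: "real_distribution M" "\<And>x. measure M {x} = 0"
    "\<And>m F. 2 \<le> m \<Longrightarrow> finite F \<Longrightarrow> F \<subseteq> {m<..} \<Longrightarrow>
      1 - 2 * pi\<^sup>2 / real m \<le> (LINT x|M. cos (2 * pi * real (\<Sum>j\<in>F. erdos_taylor j) * x))"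
    using exists_limit_distribution by blast
  interpret M: real_distribution M by fact
  define e where "e x = cis (2 * pi * x)" for x
  define \<mu> where "\<mu> = distr M (restrict_space borel unit_circle) e"
  have e_meas [measurable]: "e \<in> borel_measurable borel"
    unfolding e_def by (intro borel_measurable_continuous_onI continuous_intros)
  have meas: "e \<in> measurable M (restrict_space borel unit_circle)"
    by (intro measurable_restrict_space2) (auto simp: e_def)
  have coeff: "fourier_coeff \<mu> (int n) = (LINT x|M. cis (2 * pi * real n * x))" for n
  proof -
    have "fourier_coeff \<mu> (int n) = (LINT x|M. e x ^ n)"
      unfolding fourier_coeff_def \<mu>_def power_int_of_nat
      by (intro integral_distr meas measurable_restrict_space1) auto
    also have "(\<lambda>x. e x ^ n) = (\<lambda>x. cis (2 * pi * real n * x))"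
      unfolding e_def Complex.DeMoivre by (simp add: mult_ac)
    finally show ?thesis .
  qed
  have int_cis: "integrable M (\<lambda>x. cis (2 * pi * real n * x))" for n
  proof (rule M.integrable_const_bound[where B = 1])
    have "(\<lambda>x. cis (2 * pi * real n * x)) \<in> borel_measurable borel"
      by (intro borel_measurable_continuous_onI continuous_intros)
    then show "(\<lambda>x. cis (2 * pi * real n * x)) \<in> borel_measurable M" by simp
  qed simp
  have coeff_dist: "(norm (fourier_coeff \<mu> (int n) - 1))\<^sup>2
      \<le> 2 * (1 - (LINT x|M. cos (2 * pi * real n * x)))" for n
  proof -
    define z where "z = fourier_coeff \<mu> (int n)"
    have "norm z \<le> (LINT x|M. norm (cis (2 * pi * real n * x)))"
      unfolding z_def coeff by (rule integral_norm_bound)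
    also have "\<dots> = M.prob UNIV" by simp
    also have "\<dots> \<le> 1" by (rule M.prob_le_1)
    finally have "norm z \<le> 1" .
    then have "(norm z)\<^sup>2 \<le> 1" by (simp add: power_le_one)
    moreover have "Re z = (LINT x|M. cos (2 * pi * real n * x))"
      unfolding z_def coeff using int_cis[of n] by (subst integral_Re[symmetric]) auto
    ultimately show ?thesis
      unfolding z_def[symmetric] cmod_power2 by (simp add: power2_eq_square algebra_simps)
  qed
  have "borel_prob_on_circle \<mu>"
    unfolding borel_prob_on_circle_def \<mu>_def using M.prob_space_distr[OF meas] by simp
  moreover have "measure \<mu> {z} = 0" if "z \<in> unit_circle" for z
  proof -
    have "{z} \<in> sets (restrict_space borel unit_circle)"
      using that by (auto simp: sets_restrict_space image_iff intro!: bexI[of _ "{z}"])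
    then have "measure \<mu> {z} = measure M (e -` {z} \<inter> space M)"
      unfolding \<mu>_def by (rule measure_distr[OF meas])
    also have "\<dots> = 0"
    proof -
      \<comment> \<open>A nonempty fibre lies in a translate of the integers, hence is null for a
        law without atoms.\<close>
      have "countable (e -` {z})"
      proof (cases "e -` {z} = {}")
        case False
        then obtain x where x: "e x = z" by auto
        have "e -` {z} \<subseteq> range (\<lambda>i::int. x + of_int i)"
        proof
          fix y assume "y \<in> e -` {z}"
          then have "cis (2 * pi * y) = cis (2 * pi * x)" using x by (simp add: e_def)
          then obtain i :: int where "2 * pi * y = 2 * pi * x + 2 * pi * of_int i"
            using sin_cos_eq_iff[of "2 * pi * y" "2 * pi * x"] by (auto simp: complex_eq_iff)
          then have "2 * pi * y = 2 * pi * (x + of_int i)" by (simp add: algebra_simps)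
          then have "y = x + of_int i" by simp
          then show "y \<in> range (\<lambda>i::int. x + of_int i)" by auto
        qed
        then show ?thesis by (rule countable_subset) auto
      qed simp
      moreover have "{y} \<in> null_sets M" for y
        using M(2)[of y] by (simp add: null_sets_def M.emeasure_eq_measure)
      ultimately have "(\<Union>y\<in>e -` {z}. {y}) \<in> null_sets M" by (intro null_sets_UN')
      then show ?thesis by (simp add: measure_eq_0_null_sets)
    qed
    finally show ?thesis .
  qed
  moreover have "(\<lambda>k. fourier_coeff \<mu> (int (enumerate D k))) \<longlonglongrightarrow> 1"
  proof -
    have ev: "\<forall>\<^sub>F k in sequentially. (norm (fourier_coeff \<mu> (int (enumerate D k)) - 1))\<^sup>2 < \<epsilon>"
      if "0 < \<epsilon>" for \<epsilon> :: real
    proof -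
      obtain m :: nat where m: "max 2 (4 * pi\<^sup>2 / \<epsilon>) < real m" using reals_Archimedean2 by blast
      \<comment> \<open>Only finitely many elements of \<open>D\<close> come from the first
        \<open>m\<close> long blocks. Any element from \<open>B\<close> on comes from a later one,
        whose indices all exceed \<open>m\<close>.\<close>
      have "finite (\<Union>l<m. block_sums q l)" by (simp add: finite_block_sums)
      from iffD1[OF finite_nat_set_iff_bounded this]
      obtain B where B: "\<forall>n\<in>(\<Union>l<m. block_sums q l). n < B" by (rule exE)
      have "(norm (fourier_coeff \<mu> (int (enumerate D k)) - 1))\<^sup>2 < \<epsilon>" if "B \<le> k" for k
      proof -
        let ?n = "enumerate D k"
        have "?n \<in> D" using enumerate_in_set[OF infD] .
        then obtain l where l: "?n \<in> block_sums q l" by (auto simp: D_def)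
        have "B \<le> ?n" using le_enumerate[OF infD, of k] that by linarith
        then have "?n \<notin> (\<Union>l<m. block_sums q l)" using B by (meson not_less)
        then have "m \<le> l" using l by (meson UN_I lessThan_iff not_less)
        obtain F where F: "F \<subseteq> long_block q l" "?n = (\<Sum>j\<in>F. erdos_taylor j)"
          using l by (auto simp: block_sums_def)
        have "1 - 2 * pi\<^sup>2 / real m \<le> (LINT x|M. cos (2 * pi * real ?n * x))"
          unfolding F(2) using m F(1) long_block_subset[OF q \<open>m \<le> l\<close>] finite_subset[OF F(1) finite_long_block]
          by (intro M(3)) auto
        then have "(norm (fourier_coeff \<mu> (int ?n) - 1))\<^sup>2 \<le> 4 * pi\<^sup>2 / real m"
          using coeff_dist[of ?n] by simp
        also have "\<dots> < \<epsilon>" using m \<open>0 < \<epsilon>\<close> by (simp add: field_simps)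
        finally show ?thesis .
      qed
      then show ?thesis unfolding eventually_sequentially by blast
    qed
    show ?thesis
    proof (rule tendstoI)
      fix \<epsilon> :: real assume "0 < \<epsilon>"
      then have "0 < \<epsilon>\<^sup>2" by simp
      from ev[OF this] show "\<forall>\<^sub>F k in sequentially. dist (fourier_coeff \<mu> (int (enumerate D k))) 1 < \<epsilon>"
        by (rule eventually_mono) (use \<open>0 < \<epsilon>\<close> in \<open>auto simp: dist_norm intro: power2_less_imp_less\<close>)
    qed
  qed
  ultimately show ?thesis unfolding rigidity_sequence_def D_def by blast
qed

theorem mainTheorem9:
  fixes q :: "nat \<Rightarrow> nat" and D :: "nat set" and n :: "nat \<Rightarrow> int"
  assumes "q 0 = 0"
    and "strict_mono q"
    and "filterlim (\<lambda>l. q (l + 1) - q l) at_top sequentially"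
    and "D = (\<Union>l. block_sums q l)"
    and "n = (\<lambda>k. int (enumerate D k))"
  shows "rigidity_sequence n \<and> dense_in_bohr n"
  using rigidity_sequence_enumerate_block_sums[OF assms(2)]
    dense_in_bohr_enumerate_block_sums[OF assms(2,3)]
  unfolding assms(4,5) by blast

end
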